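(* Let $u,v\in W$ with $u\leqslant v$. Then $$\sum_{u\leqslant x\leqslant v}r_{u,x}\,\varepsilon_x\,\varepsilon_v\,r_{w_0v,w_0x}=\delta_{u,v}$$ and $$\sum_{u\leqslant x\leqslant v}m_{u,x}\,\varepsilon_x\,\varepsilon_v\,m_{w_0v,w_0x}=\delta_{u,v},$$ where $\delta$ is the Kronecker delta.
   Context: Let $\hat T(\mathbb{C})$ be a maximal torus in a complex reductive group, $\Phi$ the root system in the character lattice $X^*(\hat T)$, $\Phi^+$ a choice of positive roots, and $W$ the Weyl group with its simple reflections $s=s_\alpha$ ($\alpha$ simple), length function $l$, Bruhat order $\leqslant$ and longest element $w_0$. For $\mathbf{z}\in\hat T(\mathbb{C})$ and $\lambda\in X^*(\hat T)$, $\mathbf{z}^\lambda$ is the value of $\lambda$ at $\mathbf{z}$; $W$ acts on $\hat T(\mathbb{C})$ by $(w\mathbf{z})^\lambda=\mathbf{z}^{w^{-1}\lambda}$. Let $q$ be an indeterminate, $q_w=q^{l(w)}$ and $\varepsilon_w=(-1)^{l(w)}$. For a rational function $f$ of $q$ and $\mathbf{z}$, $\overline f$ is the result of replacing $q$ by $q^{-1}$, leaving $\mathbf{z}$ unchanged. Let $\mathcal{H}$ be the Iwahori Hecke algebra of $W$, with scalars extended to the field of rational functions in $q$ and $\mathbf{z}$, with basis $T_w$ ($w\in W$), where $T_wT_{w'}=T_{ww'}$ if $l(ww')=l(w)+l(w')$ and $T_s^2=(q-1)T_s+q$ for simple reflections $s$. For a simple reflection $s=s_\alpha$ put $$\mu_{\mathbf{z}}(s)=q^{-1}T_s+(1-q^{-1})\frac{\mathbf{z}^\alpha}{1-\mathbf{z}^\alpha}.$$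 This extends uniquely (a known fact) to elements $\mu_{\mathbf{z}}(w)$, $w\in W$, with $\mu_{\mathbf{z}}(1)=1$ and $\mu_{\mathbf{z}}(w_1w_2)=\mu_{\mathbf{z}}(w_2)\,\mu_{w_2\mathbf{z}}(w_1)$ whenever $l(w_1w_2)=l(w_1)+l(w_2)$. The functions $r_{u,v}=r_{u,v}(\mathbf{z})$ (zero unless $u\leqslant v$) are defined by $$\mu_{\mathbf{z}}(v)=\sum_{u\leqslant v}q_u^{-1}\,\overline{r_{u,v}}\,T_{u^{-1}}.$$ Let $\Lambda$ be the linear functional on $\mathcal{H}$ with $\Lambda(T_1)=1$ and $\Lambda(T_w)=0$ for $w\neq1$, let $\psi_u=\sum_{x\geqslant u}T_x$, and define $m_{u,v}=m_{u,v}(\mathbf{z})=\Lambda(\psi_u\,\mu_{\mathbf{z}}(v))$. All functions in the claim are evaluated at the same $\mathbf{z}$. *)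

theory Defs
  imports "HOL-Computational_Algebra.Polynomial_Factorial"
begin

type_synonym ratfun = "complex poly fract"

definition q :: ratfun where "q = to_fract [:0, 1:]"

definition const :: "complex \<Rightarrow> ratfun" where "const c = to_fract [:c:]"

definition eval_qinv :: "complex poly \<Rightarrow> ratfun" where
  "eval_qinv p = poly (map_poly const p) (inverse q)"

text \<open>The value of a rational function at the inverse of q. It does not depend on the choice of
  numerator and denominator, and it is the field automorphism that fixes the constants and
  inverts q (lemmas below).\<close>

definition bar :: "ratfun \<Rightarrow> ratfun" where
  "bar f = (THE g. \<exists>a b. b \<noteq> 0 \<and> f = Fract a b \<and> g = eval_qinv a / eval_qinv b)"

lemma const_0 [simp]: "const 0 = 0"
  and const_1 [simp]: "const 1 = 1"
  and const_add: "const (a + b) = const a + const b"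
  and const_mult: "const (a * b) = const a * const b"
  and const_eq_0_iff [simp]: "const a = 0 \<longleftrightarrow> a = 0"
  by (simp_all add: const_def to_fract_eq_0_iff flip: to_fract_add to_fract_mult one_pCons)

lemma q_nonzero [simp]: "q \<noteq> 0"
  by (simp add: q_def)

lemma eval_qinv_pCons [simp]: "eval_qinv (pCons a p) = const a + inverse q * eval_qinv p"
  by (cases "p = 0 \<and> a = 0") (auto simp: eval_qinv_def map_poly_pCons)

lemma eval_qinv_0 [simp]: "eval_qinv 0 = 0"
  by (simp add: eval_qinv_def)

lemma eval_qinv_add: "eval_qinv (a + b) = eval_qinv a + eval_qinv b"
  by (induction a b rule: poly_induct2) (simp_all add: const_add algebra_simps)

lemma eval_qinv_smult: "eval_qinv (smult c a) = const c * eval_qinv a"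
  by (induction a) (simp_all add: const_mult algebra_simps)

lemma eval_qinv_mult: "eval_qinv (a * b) = eval_qinv a * eval_qinv b"
  by (induction a) (simp_all add: eval_qinv_add eval_qinv_smult algebra_simps)

lemma poly_map_const_q: "poly (map_poly const p) q = to_fract p"
proof (induction p)
  case (pCons a p)
  have "to_fract (pCons a p) = to_fract ([:a:] + [:0, 1:] * p)" by simp
  also have "\<dots> = const a + q * to_fract p"
    unfolding to_fract_add to_fract_mult const_def q_def ..
  finally show ?case using pCons by (simp add: map_poly_pCons)
qed simp

lemma eval_qinv_eq_0_iff [simp]: "eval_qinv p = 0 \<longleftrightarrow> p = 0"
proof
  assume "eval_qinv p = 0"
  then have "poly (reflect_poly (map_poly const p)) q = 0"
    by (simp add: poly_reflect_poly_nz eval_qinv_def)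
  moreover have "reflect_poly (map_poly const p) = map_poly const (reflect_poly p)"
    by (rule poly_eqI) (simp add: coeff_reflect_poly coeff_map_poly degree_map_poly)
  ultimately have "to_fract (reflect_poly p) = 0"
    by (simp add: poly_map_const_q)
  then show "p = 0" by simp
qed simp

lemma bar_Fract: "b \<noteq> 0 \<Longrightarrow> bar (Fract a b) = eval_qinv a / eval_qinv b"
  unfolding bar_def
proof (rule the_equality)
  fix g
  assume b: "b \<noteq> 0"
    and "\<exists>c d. d \<noteq> 0 \<and> Fract a b = Fract c d \<and> g = eval_qinv c / eval_qinv d"
  then obtain c d where d: "d \<noteq> 0" "Fract a b = Fract c d" "g = eval_qinv c / eval_qinv d"
    by blast
  then have "a * d = c * b" using b by (simp add: eq_fract)
  then have "eval_qinv a * eval_qinv d = eval_qinv c * eval_qinv b"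
    by (metis eval_qinv_mult)
  then show "g = eval_qinv a / eval_qinv b"
    using b d(1) unfolding d(3) by (simp add: frac_eq_eq mult.commute)
qed blast

lemma eval_qinv_1 [simp]: "eval_qinv 1 = 1"
  by (simp add: eval_qinv_def)

lemma bar_const [simp]: "bar (const c) = const c"
  using bar_Fract[of 1 "[:c:]"] by (simp add: const_def to_fract_def)

lemma bar_q [simp]: "bar q = inverse q"
  using bar_Fract[of 1 "[:0, 1:]"] by (simp add: q_def to_fract_def)

lemma bar_add: "bar (f + g) = bar f + bar g"
  by (cases f; cases g) (simp add: bar_Fract eval_qinv_add eval_qinv_mult add_divide_eq_iff
      divide_add_eq_iff field_simps)

lemma bar_mult: "bar (f * g) = bar f * bar g"
  by (cases f; cases g) (simp add: bar_Fract eval_qinv_mult)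

text \<open>A complex reductive group with a maximal torus enters only through its root datum. The
  type \<^typ>\<open>'x\<close> is the character lattice, \<open>zmult\<close> its structure as a module over the integers,
  and \<open>coroot R \<alpha> x\<close> the pairing of \<open>x\<close> with the coroot of \<open>\<alpha>\<close>.\<close>

record 'x root_data =
  zmult :: "int \<Rightarrow> 'x \<Rightarrow> 'x"
  roots :: "'x set"
  coroot :: "'x \<Rightarrow> 'x \<Rightarrow> int"
  pos_roots :: "'x set"

definition reflection :: "('x::ab_group_add) root_data \<Rightarrow> 'x \<Rightarrow> 'x \<Rightarrow> 'x" where
  "reflection R \<alpha> = (\<lambda>x. x - zmult R (coroot R \<alpha> x) \<alpha>)"

locale root_datum =
  fixes R :: "('x::ab_group_add) root_data"
  assumes lattice_module: "module (zmult R)"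
    and lattice_free: "\<exists>B. finite B \<and> module.independent (zmult R) B \<and> module.span (zmult R) B = UNIV"
    and finite_roots: "finite (roots R)"
    and coroot_hom: "\<alpha> \<in> roots R \<Longrightarrow> module_hom (zmult R) (*) (coroot R \<alpha>)"
    and coroot_inj: "inj_on (coroot R) (roots R)"
    and coroot_self: "\<alpha> \<in> roots R \<Longrightarrow> coroot R \<alpha> \<alpha> = 2"
    and refl_roots: "\<alpha> \<in> roots R \<Longrightarrow> reflection R \<alpha> ` roots R = roots R"
    and refl_coroots: "\<alpha> \<in> roots R \<Longrightarrow>
      (\<lambda>f x. f x - f \<alpha> * coroot R \<alpha> x) ` (coroot R ` roots R) = coroot R ` roots R"
    and reduced: "\<alpha> \<in> roots R \<Longrightarrow> zmult R k \<alpha> \<in> roots R \<Longrightarrow> k = 1 \<or> k = -1"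
    and pos_roots_subset: "pos_roots R \<subseteq> roots R"
    and pos_or_neg: "\<alpha> \<in> roots R \<Longrightarrow> \<alpha> \<in> pos_roots R \<longleftrightarrow> - \<alpha> \<notin> pos_roots R"
    and pos_closed: "\<alpha> \<in> pos_roots R \<Longrightarrow> \<beta> \<in> pos_roots R \<Longrightarrow> \<alpha> + \<beta> \<in> roots R \<Longrightarrow>
      \<alpha> + \<beta> \<in> pos_roots R"

definition simple_roots :: "('x::ab_group_add) root_data \<Rightarrow> 'x set" where
  "simple_roots R = {\<alpha> \<in> pos_roots R. \<nexists>\<beta> \<gamma>. \<beta> \<in> pos_roots R \<and> \<gamma> \<in> pos_roots R \<and> \<alpha> = \<beta> + \<gamma>}"

text \<open>Elements of the Weyl group are maps on the lattice. Reflections are involutions, so closure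
  under products already gives the generated group.\<close>

inductive_set weyl :: "('x::ab_group_add) root_data \<Rightarrow> ('x \<Rightarrow> 'x) set" for R where
  weyl_id: "id \<in> weyl R"
| weyl_refl: "\<alpha> \<in> roots R \<Longrightarrow> w \<in> weyl R \<Longrightarrow> reflection R \<alpha> \<circ> w \<in> weyl R"

definition len :: "('x::ab_group_add) root_data \<Rightarrow> ('x \<Rightarrow> 'x) \<Rightarrow> nat" where
  "len R w = (LEAST n. \<exists>\<alpha>s. length \<alpha>s = n \<and> set \<alpha>s \<subseteq> simple_roots R \<and>
     w = foldr (\<lambda>\<alpha> v. reflection R \<alpha> \<circ> v) \<alpha>s id)"

definition bruhat :: "('x::ab_group_add) root_data \<Rightarrow> ('x \<Rightarrow> 'x) \<Rightarrow> ('x \<Rightarrow> 'x) \<Rightarrow> bool" where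
  "bruhat R = (\<lambda>u v. (\<exists>\<alpha>\<in>roots R. v = u \<circ> reflection R \<alpha>) \<and> len R u < len R v)\<^sup>*\<^sup>*"

definition longest :: "('x::ab_group_add) root_data \<Rightarrow> 'x \<Rightarrow> 'x" where
  "longest R = (ARG_MAX (len R) w. w \<in> weyl R)"

text \<open>Points of the torus are the homomorphisms from the character lattice to the multiplicative
  group of the complex numbers: \<open>z x\<close> is the value of the character \<open>x\<close> at \<open>z\<close>. The regular points are those
  where none of the denominators \<open>1 - z \<alpha>\<close> vanishes.\<close>

definition torus :: "('x::ab_group_add \<Rightarrow> complex) set" where
  "torus = {z. (\<forall>x. z x \<noteq> 0) \<and> (\<forall>x y. z (x + y) = z x * z y)}"

definition regular :: "('x::ab_group_add) root_data \<Rightarrow> ('x \<Rightarrow> complex) set" where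
  "regular R = {z \<in> torus. \<forall>\<alpha>\<in>roots R. z \<alpha> \<noteq> 1}"

definition act :: "('x \<Rightarrow> 'x) \<Rightarrow> ('x \<Rightarrow> complex) \<Rightarrow> 'x \<Rightarrow> complex" where
  "act w z = (\<lambda>x. z (inv w x))"

definition qlen :: "('x::ab_group_add) root_data \<Rightarrow> ('x \<Rightarrow> 'x) \<Rightarrow> ratfun" where
  "qlen R w = q ^ len R w"

definition sgn_len :: "('x::ab_group_add) root_data \<Rightarrow> ('x \<Rightarrow> 'x) \<Rightarrow> ratfun" where
  "sgn_len R w = (- 1) ^ len R w"

locale hecke_algebra = root_datum R + vector_space scale
  for R :: "('x::ab_group_add) root_data" and scale :: "ratfun \<Rightarrow> 'h::ring_1 \<Rightarrow> 'h" +
  fixes T :: "('x \<Rightarrow> 'x) \<Rightarrow> 'h"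
  assumes scale_mult_left: "scale c (a * b) = scale c a * b"
    and scale_mult_right: "scale c (a * b) = a * scale c b"
    and T_inj: "inj_on T (weyl R)"
    and T_independent: "independent (T ` weyl R)"
    and T_span: "span (T ` weyl R) = UNIV"
    and T_mult: "w \<in> weyl R \<Longrightarrow> w' \<in> weyl R \<Longrightarrow> len R (w \<circ> w') = len R w + len R w' \<Longrightarrow>
      T w * T w' = T (w \<circ> w')"
    and T_quadratic: "\<alpha> \<in> simple_roots R \<Longrightarrow>
      T (reflection R \<alpha>) * T (reflection R \<alpha>) = scale (q - 1) (T (reflection R \<alpha>)) + scale q 1"

text \<open>Rational functions of q and z are treated as functions of a regular point \<open>z\<close> with values in
  \<^typ>\<open>ratfun\<close>: all scalars below are regular at such points, and \<^const>\<open>bar\<close> leaves \<open>z\<close> alone.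
  The family \<open>\<mu>\<close> is determined on the Weyl group by these three properties; its existence is the
  braid relation for the elements attached to simple reflections.\<close>

locale mu_family = hecke_algebra R scale T
  for R :: "('x::ab_group_add) root_data"
    and scale :: "ratfun \<Rightarrow> 'h::ring_1 \<Rightarrow> 'h"
    and T :: "('x \<Rightarrow> 'x) \<Rightarrow> 'h" +
  fixes \<mu> :: "('x \<Rightarrow> complex) \<Rightarrow> ('x \<Rightarrow> 'x) \<Rightarrow> 'h"
  assumes mu_id: "z \<in> regular R \<Longrightarrow> \<mu> z id = 1"
    and mu_simple: "z \<in> regular R \<Longrightarrow> \<alpha> \<in> simple_roots R \<Longrightarrow>
      \<mu> z (reflection R \<alpha>) =
        scale (inverse q) (T (reflection R \<alpha>)) + scale ((1 - inverse q) * const (z \<alpha> / (1 - z \<alpha>))) 1"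
    and mu_mult: "z \<in> regular R \<Longrightarrow> w1 \<in> weyl R \<Longrightarrow> w2 \<in> weyl R \<Longrightarrow>
      len R (w1 \<circ> w2) = len R w1 + len R w2 \<Longrightarrow> \<mu> z (w1 \<circ> w2) = \<mu> z w2 * \<mu> (act w2 z) w1"

definition coeffT :: "('x::ab_group_add) root_data \<Rightarrow> (ratfun \<Rightarrow> 'h::ring_1 \<Rightarrow> 'h) \<Rightarrow>
    (('x \<Rightarrow> 'x) \<Rightarrow> 'h) \<Rightarrow> 'h \<Rightarrow> ('x \<Rightarrow> 'x) \<Rightarrow> ratfun" where
  "coeffT R scale T h w = module.representation scale (T ` weyl R) h (T w)"

text \<open>The expansion \<open>\<mu> z v = (\<Sum>u. inverse (qlen R u) * bar (r u v) * T (inv u))\<close>, solved for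
  \<open>r u v\<close>; see lemma \<open>r_coeff_unique\<close>.\<close>

definition r_coeff :: "('x::ab_group_add) root_data \<Rightarrow> (ratfun \<Rightarrow> 'h::ring_1 \<Rightarrow> 'h) \<Rightarrow>
    (('x \<Rightarrow> 'x) \<Rightarrow> 'h) \<Rightarrow> (('x \<Rightarrow> complex) \<Rightarrow> ('x \<Rightarrow> 'x) \<Rightarrow> 'h) \<Rightarrow> ('x \<Rightarrow> complex) \<Rightarrow>
    ('x \<Rightarrow> 'x) \<Rightarrow> ('x \<Rightarrow> 'x) \<Rightarrow> ratfun" where
  "r_coeff R scale T \<mu> z u v = bar (qlen R u * coeffT R scale T (\<mu> z v) (inv u))"

definition Lam :: "('x::ab_group_add) root_data \<Rightarrow> (ratfun \<Rightarrow> 'h::ring_1 \<Rightarrow> 'h) \<Rightarrow>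
    (('x \<Rightarrow> 'x) \<Rightarrow> 'h) \<Rightarrow> 'h \<Rightarrow> ratfun" where
  "Lam R scale T h = coeffT R scale T h id"

definition psi :: "('x::ab_group_add) root_data \<Rightarrow> (('x \<Rightarrow> 'x) \<Rightarrow> 'h::ring_1) \<Rightarrow> ('x \<Rightarrow> 'x) \<Rightarrow> 'h" where
  "psi R T u = (\<Sum>x \<in> {x \<in> weyl R. bruhat R u x}. T x)"

definition m_coeff :: "('x::ab_group_add) root_data \<Rightarrow> (ratfun \<Rightarrow> 'h::ring_1 \<Rightarrow> 'h) \<Rightarrow>
    (('x \<Rightarrow> 'x) \<Rightarrow> 'h) \<Rightarrow> (('x \<Rightarrow> complex) \<Rightarrow> ('x \<Rightarrow> 'x) \<Rightarrow> 'h) \<Rightarrow> ('x \<Rightarrow> complex) \<Rightarrow>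
    ('x \<Rightarrow> 'x) \<Rightarrow> ('x \<Rightarrow> 'x) \<Rightarrow> ratfun" where
  "m_coeff R scale T \<mu> z u v = Lam R scale T (psi R T u * \<mu> z v)"

lemma bar_bar [simp]: "bar (bar f) = f"
proof -
  have bar_inverse_q: "bar (inverse q) = q"
    using bar_mult[of q "inverse q"] bar_const[of 1] by (simp add: field_simps)
  have *: "bar (eval_qinv p) = to_fract p" for p
  proof (induction p)
    case 0
    show ?case using bar_const[of 0] by simp
  next
    case (pCons a p)
    have "to_fract (pCons a p) = const a + q * to_fract p"
      using poly_map_const_q[of "pCons a p"] pCons.hyps
      by (simp add: map_poly_pCons poly_map_const_q)
    with pCons show ?case by (simp add: bar_add bar_mult bar_inverse_q)
  qed
  obtain a b where f: "f = Fract a b" "b \<noteq> 0" by (cases f)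
  then have "bar f * eval_qinv b = eval_qinv a" by (simp add: bar_Fract)
  then have "bar (bar f) * to_fract b = to_fract a" by (metis * bar_mult)
  moreover have "f * to_fract b = to_fract a" using f by (simp add: Fract_conv_to_fract)
  ultimately have "bar (bar f) * to_fract b = f * to_fract b" by simp
  then show ?thesis using f by simp
qed

context hecke_algebra
begin

lemma coeffT_T: "v \<in> weyl R \<Longrightarrow> w \<in> weyl R \<Longrightarrow> coeffT R scale T (T v) w = (if v = w then 1 else 0)"
  using T_inj by (auto simp: coeffT_def representation_basis T_independent dest: inj_onD)

lemma coeffT_add: "coeffT R scale T (a + b) w = coeffT R scale T a w + coeffT R scale T b w"
  by (simp add: coeffT_def representation_add T_independent T_span)

lemma coeffT_scale: "coeffT R scale T (scale c a) w = c * coeffT R scale T a w"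
  by (simp add: coeffT_def representation_scale T_independent T_span)

lemma coeffT_sum: "coeffT R scale T (\<Sum>i\<in>I. a i) w = (\<Sum>i\<in>I. coeffT R scale T (a i) w)"
  by (simp add: coeffT_def representation_sum T_independent T_span)

lemma Lam_T: "w \<in> weyl R \<Longrightarrow> Lam R scale T (T w) = (if w = id then 1 else 0)"
  by (simp add: Lam_def coeffT_T weyl_id)

lemma reflection_involution: "\<alpha> \<in> roots R \<Longrightarrow> reflection R \<alpha> (reflection R \<alpha> x) = x"
proof -
  assume \<alpha>: "\<alpha> \<in> roots R"
  interpret X: module "zmult R" by (rule lattice_module)
  interpret C: module_hom "zmult R" "(*)" "coroot R \<alpha>" by (rule coroot_hom[OF \<alpha>])
  show ?thesis
    by (simp add: reflection_def C.diff C.scale coroot_self[OF \<alpha>] X.scale_left_diff_distrib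
        flip: X.scale_minus_left X.scale_left_distrib)
qed

lemma refl_weyl: "\<alpha> \<in> roots R \<Longrightarrow> reflection R \<alpha> \<in> weyl R"
  using weyl_refl[OF _ weyl_id] by simp

lemma weyl_comp: "w \<in> weyl R \<Longrightarrow> w' \<in> weyl R \<Longrightarrow> w \<circ> w' \<in> weyl R"
  by (induction rule: weyl.induct) (simp_all add: weyl_refl comp_assoc)

lemma bij_refl: "\<alpha> \<in> roots R \<Longrightarrow> bij (reflection R \<alpha>)"
  by (rule o_bij[of "reflection R \<alpha>"]) (auto simp: reflection_involution)

lemma inv_refl: "\<alpha> \<in> roots R \<Longrightarrow> inv (reflection R \<alpha>) = reflection R \<alpha>"
  by (rule inv_equality) (simp_all add: reflection_involution)

lemma weyl_bij_inv: "w \<in> weyl R \<Longrightarrow> bij w \<and> inv w \<in> weyl R"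
proof (induction rule: weyl.induct)
  case weyl_id
  show ?case using weyl.weyl_id[of R] by (metis bij_id inv_id)
next
  case (weyl_refl \<alpha> w)
  then show ?case
    by (metis bij_comp bij_refl inv_refl o_inv_distrib refl_weyl weyl_comp)
qed

lemma r_coeff_unique:
  assumes "finite (weyl R)" and "v \<in> weyl R"
    and zero: "\<And>u. u \<in> weyl R \<Longrightarrow> \<not> bruhat R u v \<Longrightarrow> \<rho> u = 0"
    and expansion: "\<mu> z v = (\<Sum>u \<in> {u \<in> weyl R. bruhat R u v}.
      scale (inverse (qlen R u) * bar (\<rho> u)) (T (inv u)))"
    and u: "u \<in> weyl R"
  shows "\<rho> u = r_coeff R scale T \<mu> z u v"
proof -
  let ?A = "{u \<in> weyl R. bruhat R u v}"
  have inv_eq: "inv x = inv u \<longleftrightarrow> x = u" if "x \<in> weyl R" for x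
    using weyl_bij_inv[OF that] weyl_bij_inv[OF u] by (metis inv_inv_eq)
  have "coeffT R scale T (\<mu> z v) (inv u) =
      (\<Sum>x\<in>?A. inverse (qlen R x) * bar (\<rho> x) * (if inv x = inv u then 1 else 0))"
    unfolding expansion coeffT_sum coeffT_scale
    by (intro sum.cong) (auto simp: coeffT_T weyl_bij_inv u)
  also have "\<dots> = (\<Sum>x\<in>?A. if x = u then inverse (qlen R x) * bar (\<rho> x) else 0)"
    by (intro sum.cong) (auto simp: inv_eq)
  also have "\<dots> = (if u \<in> ?A then inverse (qlen R u) * bar (\<rho> u) else 0)"
    using assms(1) by (subst sum.delta) auto
  also have "\<dots> = inverse (qlen R u) * bar (\<rho> u)"
    using zero[OF u] u bar_const[of 0] by auto
  finally have "qlen R u * coeffT R scale T (\<mu> z v) (inv u) = bar (\<rho> u)"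
    by (simp add: qlen_def)
  then show ?thesis
    by (simp add: r_coeff_def)
qed

end

end

theory Submission
  imports Defs
begin

text \<open>Let \<open>\<rho> u v\<close> be the coordinates of \<open>\<mu> z v\<close> in the basis \<open>inverse (qlen u) T (inv u)\<close>, so that
  \<open>r u v = bar (\<rho> u v)\<close>. Since \<open>\<mu> z v * \<mu> (act v z) s\<close> is a multiple of \<open>\<mu> z (s \<circ> v)\<close> for every simple
  reflection \<open>s\<close>, right multiplication by \<open>T s\<close> gives a recursion for \<open>\<rho>\<close>. Conjugating by the longest
  element turns this recursion into the one for the coefficients of \<open>T (inv v)\<close> in the basis
  \<open>\<mu> z x\<close>, whence \<open>T (inv v) = (\<Sum>x. qlen v \<epsilon> x \<epsilon> v \<rho> (w0 \<circ> v) (w0 \<circ> x) \<mu> z x)\<close>; this is the first identity.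
  As \<open>m u v = (\<Sum>y \<ge> u. \<rho> y v)\<close>, the second one follows from the first and from Verma's theorem that
  \<open>\<epsilon>\<close> sums to zero over every nontrivial Bruhat interval.

  The root datum carries no inner product. The invariant form is taken to be the sum of the squares
  of the coroots; it is only semidefinite on the lattice, but positive on the roots.\<close>

section \<open>Root systems\<close>

text \<open>Inverting t turns c = t/(1 - t) into -1 - c. When two simple factors of
  \<open>\<mu>\<close> for the same reflection meet, this -1 cancels the linear term of the
  quadratic relation and leaves a scalar. The longest element exchanges ascents with descents and
  also inverts t, so the same cancellation lets the conjugated recursion be solved for the
  coefficient at the longer element. The expansion of \<open>T (inv v)\<close> is thus verified by
  induction on v, and the identity for \<rho> results from comparing coordinates.

  Positivity is given only by closure under sums: there is no functional that is positive on the
  positive roots, and independence of the simple roots is not at hand. Both are replaced by the fact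
  that a nonempty list of positive roots never sums to zero; the order and the height used in
  inductions on roots rest on it.\<close>

context root_datum
begin

sublocale lattice: module "zmult R"
  by (rule lattice_module)

abbreviation \<sigma> :: "'x \<Rightarrow> 'x \<Rightarrow> 'x" where "\<sigma> \<equiv> reflection R"
abbreviation W :: "('x \<Rightarrow> 'x) set" where "W \<equiv> weyl R"
abbreviation \<Phi> :: "'x set" where "\<Phi> \<equiv> roots R"
abbreviation P :: "'x set" where "P \<equiv> pos_roots R"
abbreviation \<Delta> :: "'x set" where "\<Delta> \<equiv> simple_roots R"

lemma coroot_linear:
  assumes "\<alpha> \<in> \<Phi>"
  shows "coroot R \<alpha> (x + y) = coroot R \<alpha> x + coroot R \<alpha> y"
    and "coroot R \<alpha> (x - y) = coroot R \<alpha> x - coroot R \<alpha> y"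
    and "coroot R \<alpha> (- x) = - coroot R \<alpha> x"
    and "coroot R \<alpha> (zmult R k x) = k * coroot R \<alpha> x"
    and "coroot R \<alpha> 0 = 0"
proof -
  interpret C: module_hom "zmult R" "(*)" "coroot R \<alpha>" by (rule coroot_hom[OF assms])
  show "coroot R \<alpha> (x + y) = coroot R \<alpha> x + coroot R \<alpha> y"
    and "coroot R \<alpha> (x - y) = coroot R \<alpha> x - coroot R \<alpha> y"
    and "coroot R \<alpha> (- x) = - coroot R \<alpha> x"
    and "coroot R \<alpha> (zmult R k x) = k * coroot R \<alpha> x"
    and "coroot R \<alpha> 0 = 0"
    by (simp_all add: C.add C.diff C.neg C.scale C.zero)
qed

lemma refl_involution [simp]: "\<alpha> \<in> \<Phi> \<Longrightarrow> \<sigma> \<alpha> (\<sigma> \<alpha> x) = x"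
  by (simp add: reflection_def coroot_linear coroot_self lattice.scale_left_diff_distrib
      flip: lattice.scale_minus_left lattice.scale_left_distrib)

lemma refl_comp_cancel [simp]: "\<alpha> \<in> \<Phi> \<Longrightarrow> \<sigma> \<alpha> \<circ> (\<sigma> \<alpha> \<circ> w) = w"
  by (simp add: fun_eq_iff)

lemma comp_refl_cancel [simp]: "\<alpha> \<in> \<Phi> \<Longrightarrow> w \<circ> \<sigma> \<alpha> \<circ> \<sigma> \<alpha> = w"
  by (simp add: fun_eq_iff)

lemma refl_self [simp]: "\<alpha> \<in> \<Phi> \<Longrightarrow> \<sigma> \<alpha> \<alpha> = - \<alpha>"
  by (simp add: reflection_def coroot_self lattice.scale_left_distrib[of 1 1, simplified])

lemma refl_in_roots: "\<alpha> \<in> \<Phi> \<Longrightarrow> \<beta> \<in> \<Phi> \<Longrightarrow> \<sigma> \<alpha> \<beta> \<in> \<Phi>"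
  using refl_roots by blast

lemma neg_in_roots: "\<alpha> \<in> \<Phi> \<Longrightarrow> - \<alpha> \<in> \<Phi>"
  using refl_in_roots[of \<alpha> \<alpha>] by simp

lemma root_nonzero: "\<alpha> \<in> \<Phi> \<Longrightarrow> \<alpha> \<noteq> 0"
  using coroot_self[of \<alpha>] coroot_linear(5)[of \<alpha>] by auto

lemma pos_in_roots: "\<alpha> \<in> P \<Longrightarrow> \<alpha> \<in> \<Phi>"
  using pos_roots_subset by blast

lemma finite_pos: "finite P"
  using finite_subset[OF pos_roots_subset finite_roots] .

lemma neg_in_pos_iff: "\<alpha> \<in> \<Phi> \<Longrightarrow> - \<alpha> \<in> P \<longleftrightarrow> \<alpha> \<notin> P"
  using pos_or_neg by blast

lemma simple_in_pos: "\<alpha> \<in> \<Delta> \<Longrightarrow> \<alpha> \<in> P"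
  by (simp add: simple_roots_def)

lemma simple_in_roots [simp]: "\<alpha> \<in> \<Delta> \<Longrightarrow> \<alpha> \<in> \<Phi>"
  by (simp add: simple_in_pos pos_in_roots)

text \<open>Coordinates in a finite basis reduce this to the integers. In
  \<open>sum_in_roots\<close> it keeps the translates of a root by a nonzero vector
  distinct.\<close>

lemma zmult_eq_0:
  assumes "zmult R k x = 0"
  shows "k = 0 \<or> x = 0"
proof -
  obtain B where B: "finite B" "lattice.independent B" "lattice.span B = UNIV"
    using lattice_free by blast
  then obtain f where x: "x = (\<Sum>b\<in>B. zmult R (f b) b)"
    using lattice.span_finite[of B] by auto
  have "(\<Sum>b\<in>B. zmult R (k * f b) b) = 0"
    using assms unfolding x by (simp add: lattice.scale_sum_right)
  then have "k * f b = 0" if "b \<in> B" for b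
    using lattice.independentD[OF B(2) B(1) order_refl _ that, of "\<lambda>b. k * f b"] by blast
  then show ?thesis
    unfolding x by (cases "k = 0") (auto intro: sum.neutral)
qed

section \<open>The invariant form and sums of roots\<close>

definition form :: "'x \<Rightarrow> 'x \<Rightarrow> int" where
  "form x y = (\<Sum>\<gamma>\<in>\<Phi>. coroot R \<gamma> x * coroot R \<gamma> y)"

lemma form_commute: "form x y = form y x"
  by (simp add: form_def mult.commute)

lemma form_linear_right:
  "form x (y + y') = form x y + form x y'"
  "form x (y - y') = form x y - form x y'"
  "form x (- y) = - form x y"
  "form x (zmult R k y) = k * form x y"
  "form x 0 = 0"
  by (simp_all add: form_def coroot_linear algebra_simps sum.distrib sum_subtractf sum_negf
      sum_distrib_left)

lemma form_linear_left:
  "form (y + y') x = form y x + form y' x"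
  "form (y - y') x = form y x - form y' x"
  "form (- y) x = - form y x"
  "form (zmult R k y) x = k * form y x"
  by (simp_all add: form_linear_right form_commute[of _ x])

lemma form_eq_0:
  assumes "form x x \<le> 0" and "\<gamma> \<in> \<Phi>"
  shows "coroot R \<gamma> x = 0"
proof -
  have "form x x \<ge> 0" by (simp add: form_def sum_nonneg)
  then have "form x x = 0" using assms by simp
  then show ?thesis
    using assms finite_roots by (simp add: form_def sum_nonneg_eq_0_iff)
qed

lemma form_pos: "\<alpha> \<in> \<Phi> \<Longrightarrow> form \<alpha> \<alpha> > 0"
  using form_eq_0[of \<alpha> \<alpha>] coroot_self[of \<alpha>] by force

text \<open>By \<open>refl_coroots\<close> the reflection permutes the coroots as functionals, so
  the sum is merely reindexed. For this, the sum over the roots is rewritten as one over the image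
  of \<open>coroot R\<close>; finiteness makes the surjection injective.\<close>

lemma form_refl:
  assumes "\<alpha> \<in> \<Phi>"
  shows "form (\<sigma> \<alpha> x) (\<sigma> \<alpha> y) = form x y"
proof -
  let ?C = "coroot R ` \<Phi>"
  let ?g = "\<lambda>f x. f x - f \<alpha> * coroot R \<alpha> x"
  have form: "form x y = (\<Sum>f\<in>?C. f x * f y)" for x y
    by (simp add: form_def sum.reindex[OF coroot_inj])
  have "inj_on ?g ?C"
    by (rule eq_card_imp_inj_on) (simp_all add: finite_roots refl_coroots[OF assms])
  then have "form x y = (\<Sum>f\<in>?C. ?g f x * ?g f y)"
    using sum.reindex[of ?g ?C "\<lambda>f. f x * f y"] by (simp add: form refl_coroots[OF assms])
  also have "\<dots> = form (\<sigma> \<alpha> x) (\<sigma> \<alpha> y)"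
    unfolding form by (rule sum.cong) (auto simp: reflection_def coroot_linear algebra_simps)
  finally show ?thesis ..
qed

text \<open>Invariance, applied to \<alpha> and y. The form thus determines each coroot, which
  yields the equivariance \<open>coroot_weyl\<close>; the axioms only say that the set of coroots is
  preserved.\<close>

lemma coroot_form:
  assumes "\<alpha> \<in> \<Phi>"
  shows "coroot R \<alpha> y * form \<alpha> \<alpha> = 2 * form \<alpha> y"
proof -
  have "form (- \<alpha>) (\<sigma> \<alpha> y) = form \<alpha> y"
    using form_refl[OF assms, of \<alpha> y] assms by simp
  then show ?thesis
    by (simp add: reflection_def form_linear_left form_linear_right)
qed

lemma coroot_neg_iff: "\<alpha> \<in> \<Phi> \<Longrightarrow> coroot R \<alpha> y < 0 \<longleftrightarrow> form \<alpha> y < 0"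
  using coroot_form[of \<alpha> y] form_pos[of \<alpha>] by (smt (verit) mult_less_0_iff)

text \<open>If one of the two Cartan integers is -1, the sum is a reflected root. If both are at
  most -2, a positive definite form would force \<alpha> = -\<beta>; here it only follows that
  \<alpha> + \<beta> is isotropic, and finiteness of the set of roots has to finish the
  case.\<close>

lemma sum_in_roots:
  assumes \<alpha>: "\<alpha> \<in> \<Phi>" and \<beta>: "\<beta> \<in> \<Phi>" and neg: "form \<alpha> \<beta> < 0" and ne: "\<alpha> \<noteq> - \<beta>"
  shows "\<alpha> + \<beta> \<in> \<Phi>"
proof -
  let ?n = "coroot R \<alpha> \<beta>" and ?n' = "coroot R \<beta> \<alpha>"
  have lt: "?n < 0" "?n' < 0"
    using neg \<alpha> \<beta> by (simp_all add: coroot_neg_iff form_commute)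
  consider "?n = -1" | "?n' = -1" | "?n \<le> -2" "?n' \<le> -2"
    using lt by linarith
  then show ?thesis
  proof cases
    case 1
    then show ?thesis
      using refl_in_roots[OF \<alpha> \<beta>] by (simp add: reflection_def add.commute)
  next
    case 2
    then show ?thesis
      using refl_in_roots[OF \<beta> \<alpha>] by (simp add: reflection_def)
  next
    case 3
    let ?\<delta> = "\<alpha> + \<beta>"
    have "?n * form \<alpha> \<alpha> \<le> -2 * form \<alpha> \<alpha>" "?n' * form \<beta> \<beta> \<le> -2 * form \<beta> \<beta>"
      using mult_right_mono[OF 3(1), of "form \<alpha> \<alpha>"] mult_right_mono[OF 3(2), of "form \<beta> \<beta>"]
        form_pos[OF \<alpha>] form_pos[OF \<beta>] by simp_all
    then have "form ?\<delta> ?\<delta> \<le> 0"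
      using coroot_form[OF \<alpha>, of \<beta>] coroot_form[OF \<beta>, of \<alpha>]
      by (simp add: form_linear_left form_linear_right form_commute[of \<beta> \<alpha>])
    then have \<delta>: "coroot R \<gamma> ?\<delta> = 0" if "\<gamma> \<in> \<Phi>" for \<gamma>
      using form_eq_0 that by blast
    then have n: "?n = -2" "?n' = -2"
      using \<alpha> \<beta> \<delta>[OF \<alpha>] \<delta>[OF \<beta>] by (simp_all add: coroot_linear coroot_self)
    \<comment> \<open>The product of the two reflections translates \<open>\<alpha>\<close> by \<open>2\<delta>\<close>, which would give infinitely many roots.\<close>
    let ?f = "\<lambda>k. \<alpha> + zmult R (2 * int k) ?\<delta>"
    have "?f k \<in> \<Phi>" for k
    proof (induction k)
      case 0
      then show ?case using \<alpha> by simp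
    next
      case (Suc k)
      let ?y = "?f k"
      have c: "coroot R \<alpha> ?y = 2" "coroot R \<beta> ?y = -2"
        using \<alpha> \<beta> n \<delta> by (simp_all add: coroot_linear(1,4) coroot_self)
      have \<beta>y: "\<sigma> \<beta> ?y = ?y + zmult R 2 \<beta>"
        unfolding reflection_def c by simp
      have "coroot R \<alpha> (?y + zmult R 2 \<beta>) = -2"
        using c(1) n \<alpha> by (simp add: coroot_linear(1,4))
      then have "\<sigma> \<alpha> (\<sigma> \<beta> ?y) = ?y + zmult R 2 \<beta> + zmult R 2 \<alpha>"
        unfolding \<beta>y by (simp add: reflection_def)
      also have "\<dots> = ?f (Suc k)"
        by (simp add: algebra_simps lattice.scale_left_distrib lattice.scale_right_distrib)
      finally show ?case using Suc \<alpha> \<beta> refl_in_roots by metis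
    qed
    then have "\<not> inj ?f"
      using finite_roots by (metis finite_imageD finite_subset image_subsetI infinite_UNIV_nat)
    then obtain k l where kl: "k \<noteq> l" "zmult R (2 * int k) ?\<delta> = zmult R (2 * int l) ?\<delta>"
      by (auto simp: inj_on_def)
    then have "zmult R (2 * int k - 2 * int l) ?\<delta> = 0"
      by (simp only: lattice.scale_left_diff_distrib) simp
    then have "?\<delta> = 0" using zmult_eq_0 kl(1) by fastforce
    then show ?thesis using ne by (simp add: eq_neg_iff_add_eq_0)
  qed
qed

lemma diff_in_roots:
  assumes "\<alpha> \<in> \<Phi>" and "\<beta> \<in> \<Phi>" and "form \<alpha> \<beta> > 0" and "\<alpha> \<noteq> \<beta>"
  shows "\<alpha> - \<beta> \<in> \<Phi>"
  using sum_in_roots[of \<alpha> "- \<beta>"] assms by (simp add: neg_in_roots form_linear_right)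

text \<open>In a vanishing sum the first root has negative product with some other entry. Their sum
  is again a positive root, so merging the two gives a shorter list with the same sum.\<close>

lemma sum_list_pos_nonzero:
  assumes "set \<beta>s \<subseteq> P" and "\<beta>s \<noteq> []"
  shows "sum_list \<beta>s \<noteq> 0"
  using assms
proof (induction "length \<beta>s" arbitrary: \<beta>s rule: less_induct)
  case less
  obtain \<beta> bs where \<beta>s: "\<beta>s = \<beta> # bs" using less.prems by (cases \<beta>s) auto
  have \<beta>: "\<beta> \<in> P" using less.prems \<beta>s by simp
  show ?case
  proof
    assume 0: "sum_list \<beta>s = 0"
    have form_list: "form \<beta> (sum_list xs) = (\<Sum>b\<leftarrow>xs. form \<beta> b)" for xs
      by (induction xs) (simp_all add: form_linear_right)
    have "form \<beta> \<beta> + (\<Sum>b\<leftarrow>bs. form \<beta> b) = 0"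
      using 0 by (simp flip: form_list form_linear_right(1) add: \<beta>s form_linear_right(5))
    then have "(\<Sum>b\<leftarrow>bs. form \<beta> b) < 0"
      using form_pos[OF pos_in_roots[OF \<beta>]] by linarith
    then obtain b where b: "b \<in> set bs" "form \<beta> b < 0"
      using sum_list_nonneg[of "map (form \<beta>) bs"] by force
    then have bP: "b \<in> P" using less.prems \<beta>s by auto
    have "\<beta> \<noteq> - b"
      using \<beta> bP neg_in_pos_iff pos_in_roots by blast
    then have "\<beta> + b \<in> P"
      using sum_in_roots b bP \<beta> pos_closed pos_in_roots by blast
    moreover obtain us vs where bs: "bs = us @ b # vs"
      using b(1) by (meson split_list)
    ultimately have "sum_list ((\<beta> + b) # us @ vs) \<noteq> 0"
      using less.prems \<beta>s by (intro less.hyps) auto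
    then show False using 0 by (simp add: \<beta>s bs algebra_simps)
  qed
qed

section \<open>The order defined by sums of positive roots\<close>

definition cone :: "'x set" where
  "cone = {sum_list \<beta>s |\<beta>s. set \<beta>s \<subseteq> P}"

lemma cone_0: "0 \<in> cone"
  by (auto simp: cone_def intro: exI[of _ "[]"])

lemma cone_pos: "\<beta> \<in> P \<Longrightarrow> \<beta> \<in> cone"
  by (auto simp: cone_def intro: exI[of _ "[\<beta>]"])

lemma cone_add: "x \<in> cone \<Longrightarrow> y \<in> cone \<Longrightarrow> x + y \<in> cone"
  unfolding cone_def by clarsimp (metis le_sup_iff set_append sum_list_append)

lemma cone_scale: "x \<in> cone \<Longrightarrow> zmult R (int n) x \<in> cone"
  by (induction n) (simp_all add: cone_0 cone_add lattice.scale_left_distrib)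

text \<open>The lists for \<open>x\<close> and \<open>- x\<close> concatenate to a list of positive
  roots with sum zero, which must be empty. This is antisymmetry of the order given by
  \<open>x - y \<in> cone\<close>.\<close>

lemma cone_neg:
  assumes "x \<in> cone" and "- x \<in> cone"
  shows "x = 0"
proof -
  obtain xs ys where "x = sum_list xs" "- x = sum_list ys" "set xs \<subseteq> P" "set ys \<subseteq> P"
    using assms by (auto simp: cone_def)
  then show ?thesis
    using sum_list_pos_nonzero[of "xs @ ys"] by (metis add.right_inverse le_sup_iff
        append_is_Nil_conv set_append sum_list.Nil sum_list_append)
qed

lemma root_in_cone: "\<alpha> \<in> \<Phi> \<Longrightarrow> \<alpha> \<in> cone \<Longrightarrow> \<alpha> \<in> P"
  using cone_neg cone_pos neg_in_pos_iff root_nonzero by blast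

text \<open>The usual height adds up coefficients over the simple roots and presupposes their
  independence. Counting the positive roots below \<open>x\<close> gives a measure that decreases
  along the order without it.\<close>

definition height :: "'x \<Rightarrow> nat" where
  "height x = card {\<gamma> \<in> P. x - \<gamma> \<in> cone}"

lemma height_less:
  assumes "x - y \<in> cone" and "x \<noteq> y" and "x \<in> P"
  shows "height y < height x"
  unfolding height_def
proof (rule psubset_card_mono)
  have "x - \<gamma> \<in> cone" if "y - \<gamma> \<in> cone" for \<gamma>
    using cone_add[OF assms(1) that] by simp
  moreover have "y - x \<notin> cone"
    using cone_neg[of "x - y"] assms by auto
  ultimately show "{\<gamma> \<in> P. y - \<gamma> \<in> cone} \<subset> {\<gamma> \<in> P. x - \<gamma> \<in> cone}"
    using assms(3) cone_0 by fastforce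
qed (simp add: finite_pos)

lemma pos_sum_simple:
  assumes "\<beta> \<in> P"
  shows "\<exists>\<alpha>s. set \<alpha>s \<subseteq> \<Delta> \<and> \<beta> = sum_list \<alpha>s"
  using assms
proof (induction "height \<beta>" arbitrary: \<beta> rule: less_induct)
  case less
  show ?case
  proof (cases "\<beta> \<in> \<Delta>")
    case True
    then show ?thesis by (intro exI[of _ "[\<beta>]"]) simp
  next
    case False
    then obtain \<gamma> \<delta> where \<gamma>\<delta>: "\<gamma> \<in> P" "\<delta> \<in> P" "\<beta> = \<gamma> + \<delta>"
      using less.prems by (auto simp: simple_roots_def)
    then have "height \<gamma> < height \<beta>" "height \<delta> < height \<beta>"
      using less.prems root_nonzero pos_in_roots by (auto intro!: height_less simp: cone_pos)
    then obtain xs ys where "set xs \<subseteq> \<Delta>" "\<gamma> = sum_list xs" "set ys \<subseteq> \<Delta>" "\<delta> = sum_list ys"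
      using less.hyps \<gamma>\<delta> by metis
    then show ?thesis
      using \<gamma>\<delta>(3) by (intro exI[of _ "xs @ ys"]) simp
  qed
qed

text \<open>Comparing coefficients over the simple roots would settle this if they were known to be
  independent. The contradiction is instead a vanishing sum of positive roots.\<close>

lemma refl_simple_pos:
  assumes \<alpha>: "\<alpha> \<in> \<Delta>" and \<beta>: "\<beta> \<in> P" and ne: "\<beta> \<noteq> \<alpha>"
  shows "\<sigma> \<alpha> \<beta> \<in> P"
proof (rule ccontr)
  assume neg: "\<sigma> \<alpha> \<beta> \<notin> P"
  have \<alpha>\<Phi>: "\<alpha> \<in> \<Phi>" "\<alpha> \<in> P" and \<beta>\<Phi>: "\<beta> \<in> \<Phi>"
    using \<alpha> \<beta> by (simp_all add: simple_in_pos pos_in_roots)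
  have indec: "\<not> (\<gamma> \<in> P \<and> \<alpha> - \<gamma> \<in> P)" for \<gamma>
    using \<alpha> unfolding simple_roots_def by force
  \<comment> \<open>\<open>n \<alpha>\<close> is a sum of two positive roots other than \<open>\<alpha>\<close>. Half of the copies of \<open>\<alpha>\<close> can be taken off
    each of them without leaving the positive roots, and then nothing is left.\<close>
  have strip: "\<gamma> - zmult R (int k) \<alpha> \<in> P"
    if \<gamma>: "\<gamma> \<in> P" "\<gamma> \<noteq> \<alpha>" and k: "2 * int k \<le> coroot R \<alpha> \<gamma> + 1" for \<gamma> k
    using k
  proof (induction k)
    case 0
    then show ?case using \<gamma> by simp
  next
    case (Suc k)
    let ?x = "\<gamma> - zmult R (int k) \<alpha>"
    have x: "?x \<in> P" using Suc by simp
    have "coroot R \<alpha> ?x > 0"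
      using Suc.prems \<alpha>\<Phi> by (simp add: coroot_linear coroot_self)
    then have "coroot R \<alpha> ?x * form \<alpha> \<alpha> > 0"
      using form_pos[OF \<alpha>\<Phi>(1)] by simp
    then have "form ?x \<alpha> > 0"
      unfolding coroot_form[OF \<alpha>\<Phi>(1)] form_commute[of ?x \<alpha>] by simp
    moreover have "?x \<noteq> \<alpha>"
    proof
      assume "?x = \<alpha>"
      then have \<gamma>_eq: "\<gamma> = zmult R (int k + 1) \<alpha>"
        by (simp add: lattice.scale_left_distrib algebra_simps)
      then have "int k + 1 = 1 \<or> int k + 1 = -1"
        using reduced \<alpha>\<Phi>(1) \<gamma>(1) pos_in_roots by metis
      then have "k = 0" by simp
      with \<gamma>_eq \<gamma>(2) show False by simp
    qed
    ultimately have "?x - \<alpha> \<in> \<Phi>"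
      using diff_in_roots x pos_in_roots \<alpha>\<Phi> by blast
    moreover have "\<alpha> - ?x \<notin> P" using indec x by blast
    ultimately have "?x - \<alpha> \<in> P" using neg_in_pos_iff[of "?x - \<alpha>"] by simp
    then show ?case by (simp add: lattice.scale_left_distrib algebra_simps)
  qed
  let ?\<beta>' = "- \<sigma> \<alpha> \<beta>" and ?n = "coroot R \<alpha> \<beta>"
  have \<beta>': "?\<beta>' \<in> P"
    using neg neg_in_pos_iff refl_in_roots \<alpha>\<Phi> \<beta>\<Phi> by blast
  have "?\<beta>' \<noteq> \<alpha>"
    using ne \<alpha>\<Phi> by (metis minus_minus refl_involution refl_self)
  moreover have n: "coroot R \<alpha> ?\<beta>' = ?n" "?\<beta>' = zmult R ?n \<alpha> - \<beta>"
    using \<alpha>\<Phi> by (simp_all add: reflection_def coroot_linear coroot_self)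
  ultimately have k: "\<beta> - zmult R (int k) \<alpha> \<in> P \<and> ?\<beta>' - zmult R (int k) \<alpha> \<in> P"
    if "2 * int k \<le> ?n + 1" for k
    using strip[OF \<beta> ne that] strip[OF \<beta>', of k] that by simp
  \<comment> \<open>Otherwise \<open>\<sigma> \<alpha> \<beta>\<close> is \<beta> plus copies of
    \<alpha>, hence positive.\<close>
  have "?n > 0"
  proof (rule ccontr)
    assume "\<not> ?n > 0"
    then have "zmult R (int (nat (- ?n))) \<alpha> \<in> cone"
      using cone_scale cone_pos \<alpha>\<Phi> by blast
    then have "\<beta> + zmult R (- ?n) \<alpha> \<in> cone"
      using \<open>\<not> ?n > 0\<close> cone_add[OF cone_pos[OF \<beta>], of "zmult R (- ?n) \<alpha>"] by simp
    then show False
      using neg root_in_cone refl_in_roots[OF \<alpha>\<Phi>(1) \<beta>\<Phi>] by (simp add: reflection_def)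
  qed
  \<comment> \<open>For odd \<open>?n\<close>, rounding up removes one copy of \<alpha> too many:
    the two stripped roots add up to -\<alpha>, and \<alpha> joins the list to make the sum
    vanish.\<close>
  define k where "k = nat ((?n + 1) div 2)"
  then have k': "2 * int k = ?n \<or> 2 * int k = ?n + 1" using \<open>?n > 0\<close> by auto
  have x: "\<beta> - zmult R (int k) \<alpha> \<in> P" "?\<beta>' - zmult R (int k) \<alpha> \<in> P"
    using k[of k] k' by auto
  have "zmult R (?n - 2 * int k) \<alpha> = zmult R ?n \<alpha> - (zmult R (int k) \<alpha> + zmult R (int k) \<alpha>)"
    by (simp only: lattice.scale_left_diff_distrib lattice.scale_left_distrib mult_2)
  then have sum: "(\<beta> - zmult R (int k) \<alpha>) + (?\<beta>' - zmult R (int k) \<alpha>) = zmult R (?n - 2 * int k) \<alpha>"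
    unfolding n(2) by simp
  have "sum_list [\<beta> - zmult R (int k) \<alpha>, ?\<beta>' - zmult R (int k) \<alpha>] = 0
      \<or> sum_list [\<beta> - zmult R (int k) \<alpha>, ?\<beta>' - zmult R (int k) \<alpha>, \<alpha>] = 0"
    using k' by (auto simp only: sum_list.Cons sum_list.Nil add_0_right add.assoc[symmetric] sum) auto
  moreover have "sum_list [\<beta> - zmult R (int k) \<alpha>, ?\<beta>' - zmult R (int k) \<alpha>] \<noteq> 0"
    "sum_list [\<beta> - zmult R (int k) \<alpha>, ?\<beta>' - zmult R (int k) \<alpha>, \<alpha>] \<noteq> 0"
    using x \<alpha>\<Phi> by (intro sum_list_pos_nonzero; simp)+
  ultimately show False by blast
qed

section \<open>The Weyl group\<close>

lemma weyl_induct [consumes 1, case_names id refl]: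
  assumes "w \<in> W" and "Q id" and "\<And>\<alpha> w. \<alpha> \<in> \<Phi> \<Longrightarrow> w \<in> W \<Longrightarrow> Q w \<Longrightarrow> Q (\<sigma> \<alpha> \<circ> w)"
  shows "Q w"
  using weyl.induct[of w R Q] assms by (simp add: id_def comp_def)

lemma refl_in_weyl [simp]: "\<alpha> \<in> \<Phi> \<Longrightarrow> \<sigma> \<alpha> \<in> W"
  using weyl_refl[OF _ weyl_id] by simp

lemma comp_in_weyl [simp]: "w \<in> W \<Longrightarrow> w' \<in> W \<Longrightarrow> w \<circ> w' \<in> W"
  by (induction rule: weyl_induct) (simp_all add: weyl_refl comp_assoc)

lemma bij_reflection: "\<alpha> \<in> \<Phi> \<Longrightarrow> bij (\<sigma> \<alpha>)"
  by (rule o_bij[of "\<sigma> \<alpha>"]) auto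

lemma inv_reflection [simp]: "\<alpha> \<in> \<Phi> \<Longrightarrow> inv (\<sigma> \<alpha>) = \<sigma> \<alpha>"
  by (rule inv_equality) simp_all

lemma weyl_bij: "w \<in> W \<Longrightarrow> bij w"
proof (induction rule: weyl_induct)
  case id
  show "bij (id :: 'x \<Rightarrow> 'x)" by simp
next
  case (refl \<alpha> w)
  then show "bij (\<sigma> \<alpha> \<circ> w)" by (intro bij_comp bij_reflection)
qed

lemma inv_in_weyl [simp]: "w \<in> W \<Longrightarrow> inv w \<in> W"
proof (induction rule: weyl_induct)
  case id
  show "inv id \<in> W" by (simp add: weyl_id)
next
  case (refl \<alpha> w)
  then show "inv (\<sigma> \<alpha> \<circ> w) \<in> W" by (simp add: o_inv_distrib bij_reflection weyl_bij)
qed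

lemma weyl_inv_apply [simp]:
  "w \<in> W \<Longrightarrow> inv w (w x) = x" "w \<in> W \<Longrightarrow> w (inv w x) = x"
  "w \<in> W \<Longrightarrow> inv (inv w) = w"
  using weyl_bij[of w] by (simp_all add: bij_is_inj bij_is_surj surj_f_inv_f inv_inv_eq)

lemma inv_comp_weyl: "w \<in> W \<Longrightarrow> w' \<in> W \<Longrightarrow> inv (w \<circ> w') = inv w' \<circ> inv w"
  by (simp add: o_inv_distrib weyl_bij)

lemma inv_weyl_eq_iff: "w \<in> W \<Longrightarrow> w' \<in> W \<Longrightarrow> inv w = inv w' \<longleftrightarrow> w = w'"
  by (metis weyl_inv_apply(3))

lemma refl_linear:
  assumes "\<alpha> \<in> \<Phi>"
  shows "\<sigma> \<alpha> (x + y) = \<sigma> \<alpha> x + \<sigma> \<alpha> y" and "\<sigma> \<alpha> (zmult R k x) = zmult R k (\<sigma> \<alpha> x)"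
  using assms by (simp_all add: reflection_def coroot_linear lattice.scale_left_distrib
      lattice.scale_right_diff_distrib)

lemma weyl_add: "w \<in> W \<Longrightarrow> w (x + y) = w x + w y"
  by (induction arbitrary: x y rule: weyl_induct) (simp_all add: refl_linear)

lemma weyl_zmult: "w \<in> W \<Longrightarrow> w (zmult R k x) = zmult R k (w x)"
  by (induction arbitrary: x rule: weyl_induct) (simp_all add: refl_linear)

lemma weyl_0 [simp]: "w \<in> W \<Longrightarrow> w 0 = 0"
  using weyl_add[of w 0 0] by simp

lemma weyl_neg: "w \<in> W \<Longrightarrow> w (- x) = - w x"
  using weyl_add[of w x "- x"] by (simp add: eq_neg_iff_add_eq_0 add.commute)

lemma weyl_diff: "w \<in> W \<Longrightarrow> w (x - y) = w x - w y"
  using weyl_add[of w x "- y"] by (simp add: weyl_neg)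

lemma weyl_root: "w \<in> W \<Longrightarrow> \<alpha> \<in> \<Phi> \<Longrightarrow> w \<alpha> \<in> \<Phi>"
  by (induction arbitrary: \<alpha> rule: weyl_induct) (simp_all add: refl_in_roots)

lemma form_weyl: "w \<in> W \<Longrightarrow> form (w x) (w y) = form x y"
  by (induction arbitrary: x y rule: weyl_induct) (simp_all add: form_refl)

lemma coroot_weyl:
  assumes "w \<in> W" and \<alpha>: "\<alpha> \<in> \<Phi>"
  shows "coroot R (w \<alpha>) (w y) = coroot R \<alpha> y"
  using coroot_form[OF weyl_root[OF assms], of "w y"] coroot_form[OF \<alpha>, of y] form_pos[OF \<alpha>]
  by (simp add: form_weyl assms(1)) (metis less_irrefl mult_right_cancel)

lemma refl_conj: "w \<in> W \<Longrightarrow> \<alpha> \<in> \<Phi> \<Longrightarrow> \<sigma> (w \<alpha>) \<circ> w = w \<circ> \<sigma> \<alpha>"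
  by (simp add: fun_eq_iff reflection_def coroot_weyl weyl_diff weyl_zmult)

lemma refl_conj_inv: "w \<in> W \<Longrightarrow> \<alpha> \<in> \<Phi> \<Longrightarrow> w \<circ> \<sigma> (inv w \<alpha>) = \<sigma> \<alpha> \<circ> w"
  using refl_conj[of w "inv w \<alpha>"] by (simp add: weyl_root)

lemma refl_neg: "\<alpha> \<in> \<Phi> \<Longrightarrow> \<sigma> (- \<alpha>) = \<sigma> \<alpha>"
  using refl_conj[of "\<sigma> \<alpha>" \<alpha>] comp_refl_cancel[of \<alpha> "\<sigma> (- \<alpha>)"] by simp

lemma refl_pos_ex: "\<alpha> \<in> \<Phi> \<Longrightarrow> \<exists>\<beta>\<in>P. \<sigma> \<alpha> = \<sigma> \<beta>"
  using refl_neg neg_in_pos_iff by metis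

lemma weyl_sum_list: "w \<in> W \<Longrightarrow> w (sum_list xs) = (\<Sum>x\<leftarrow>xs. w x)"
  by (induction xs) (simp_all add: weyl_add)

section \<open>Inversions, words and length\<close>

definition inversions :: "('x \<Rightarrow> 'x) \<Rightarrow> 'x set" where
  "inversions w = {\<gamma> \<in> P. w \<gamma> \<notin> P}"

lemma finite_inversions [simp]: "finite (inversions w)"
  by (simp add: inversions_def finite_pos)

text \<open>A simple reflection permutes the positive roots other than \<alpha>, so it transports
  the inversions of \<open>w\<close>, and \<alpha> itself becomes a new one.\<close>

lemma inversions_refl_right:
  assumes "w \<in> W" and "\<alpha> \<in> \<Delta>" and "w \<alpha> \<in> P"
  shows "card (inversions (w \<circ> \<sigma> \<alpha>)) = Suc (card (inversions w))"
proof -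
  have \<alpha>: "\<alpha> \<in> \<Phi>" "\<alpha> \<in> P" "- \<alpha> \<notin> P"
    using assms(2) by (simp_all add: simple_in_pos neg_in_pos_iff)
  have "- w \<alpha> \<notin> P"
    using assms \<alpha>(1) by (simp add: neg_in_pos_iff weyl_root)
  have "inversions (w \<circ> \<sigma> \<alpha>) = insert \<alpha> (\<sigma> \<alpha> ` inversions w)"
  proof (intro equalityI subsetI)
    fix \<gamma> assume \<gamma>: "\<gamma> \<in> inversions (w \<circ> \<sigma> \<alpha>)"
    show "\<gamma> \<in> insert \<alpha> (\<sigma> \<alpha> ` inversions w)"
    proof (cases "\<gamma> = \<alpha>")
      case False
      then have "\<sigma> \<alpha> \<gamma> \<in> inversions w"
        using \<gamma> refl_simple_pos assms(2) by (auto simp: inversions_def)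
      then show ?thesis using \<alpha> by (metis imageI insertCI refl_involution)
    qed simp
  next
    fix \<gamma> assume "\<gamma> \<in> insert \<alpha> (\<sigma> \<alpha> ` inversions w)"
    then consider "\<gamma> = \<alpha>" | \<delta> where "\<delta> \<in> P" "w \<delta> \<notin> P" "\<delta> \<noteq> \<alpha>" "\<gamma> = \<sigma> \<alpha> \<delta>"
      using assms(3) by (auto simp: inversions_def)
    then show "\<gamma> \<in> inversions (w \<circ> \<sigma> \<alpha>)"
      using \<alpha> \<open>- w \<alpha> \<notin> P\<close> assms
      by cases (auto simp: inversions_def weyl_neg refl_simple_pos)
  qed
  moreover have "\<alpha> \<notin> \<sigma> \<alpha> ` inversions w"
  proof
    assume "\<alpha> \<in> \<sigma> \<alpha> ` inversions w"
    then obtain \<delta> where "\<delta> \<in> P" "\<alpha> = \<sigma> \<alpha> \<delta>" by (auto simp: inversions_def)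
    then show False using \<alpha> by (metis refl_involution refl_self)
  qed
  moreover have "inj (\<sigma> \<alpha>)" using bij_reflection \<alpha> bij_is_inj by blast
  ultimately show ?thesis
    by (simp add: card_image inj_on_subset)
qed

text \<open>An inversion \<open>\<delta>\<close> of \<open>w\<close> yields the inversion \<open>\<sigma> \<gamma> \<delta>\<close> of \<open>w \<circ> \<sigma> \<gamma>\<close> if this root is positive, and
  is itself an inversion of \<open>w \<circ> \<sigma> \<gamma>\<close> otherwise; \<open>\<gamma>\<close> is a further one.\<close>

lemma inversions_less_refl:
  assumes "w \<in> W" and \<gamma>: "\<gamma> \<in> P" and w\<gamma>: "w \<gamma> \<in> P"
  shows "card (inversions w) < card (inversions (w \<circ> \<sigma> \<gamma>))"
proof -
  have \<gamma>\<Phi>: "\<gamma> \<in> \<Phi>" "- \<gamma> \<notin> P" using \<gamma> by (simp_all add: pos_in_roots neg_in_pos_iff)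
  define f where "f \<delta> = (if \<sigma> \<gamma> \<delta> \<in> P then \<sigma> \<gamma> \<delta> else \<delta>)" for \<delta>
  have "inj_on f (inversions w)"
    using \<gamma>\<Phi> by (auto simp: inj_on_def f_def inversions_def split: if_splits) (metis refl_involution)+
  moreover have "f ` inversions w \<subseteq> inversions (w \<circ> \<sigma> \<gamma>) - {\<gamma>}"
  proof clarify
    fix \<delta> assume \<delta>: "\<delta> \<in> inversions w"
    then have \<delta>P: "\<delta> \<in> P" "\<delta> \<in> \<Phi>" "w \<delta> \<notin> P" "\<delta> \<noteq> \<gamma>"
      using w\<gamma> pos_in_roots by (auto simp: inversions_def)
    show "f \<delta> \<in> inversions (w \<circ> \<sigma> \<gamma>) - {\<gamma>}"
    proof (cases "\<sigma> \<gamma> \<delta> \<in> P")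
      case True
      moreover have "\<sigma> \<gamma> \<delta> \<noteq> \<gamma>"
        using \<delta>P \<gamma>\<Phi> by (metis refl_involution refl_self)
      ultimately show ?thesis
        using \<delta>P \<gamma>\<Phi> by (simp add: f_def inversions_def)
    next
      case False
      \<comment> \<open>As \<open>\<sigma> \<gamma> \<delta>\<close> = \<delta> - n \<gamma> is
        negative, n is positive. Hence its image under \<open>- w\<close>, namely
        \<open>- w \<delta>\<close> plus n copies of \<open>w \<gamma>\<close>, is a sum of positive
        roots.\<close>
      let ?n = "coroot R \<gamma> \<delta>"
      have "?n > 0"
      proof (rule ccontr)
        assume "\<not> ?n > 0"
        then have "\<delta> + zmult R (int (nat (- ?n))) \<gamma> \<in> cone"
          using \<gamma> \<delta>P(1) by (intro cone_add cone_scale cone_pos)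
        with \<open>\<not> ?n > 0\<close> have "\<sigma> \<gamma> \<delta> \<in> cone" by (simp add: reflection_def)
        then show False using False root_in_cone refl_in_roots \<gamma>\<Phi> \<delta>P by blast
      qed
      have "- w \<delta> \<in> P" using \<delta>P neg_in_pos_iff weyl_root assms(1) by blast
      then have "- w \<delta> + zmult R (int (nat ?n)) (w \<gamma>) \<in> cone"
        using w\<gamma> by (intro cone_add cone_scale cone_pos)
      moreover have "- w \<delta> + zmult R ?n (w \<gamma>) = - w (\<sigma> \<gamma> \<delta>)"
        using assms(1) by (simp add: reflection_def weyl_diff weyl_zmult)
      ultimately have "- w (\<sigma> \<gamma> \<delta>) \<in> cone" using \<open>?n > 0\<close> by simp
      moreover have "w (\<sigma> \<gamma> \<delta>) \<in> \<Phi>"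
        using assms(1) refl_in_roots \<gamma>\<Phi> \<delta>P weyl_root by blast
      ultimately have "w (\<sigma> \<gamma> \<delta>) \<notin> P"
        using root_in_cone neg_in_roots neg_in_pos_iff by blast
      then show ?thesis using False \<delta>P by (simp add: f_def inversions_def)
    qed
  qed
  moreover have "\<gamma> \<in> inversions (w \<circ> \<sigma> \<gamma>)"
    using \<gamma> \<gamma>\<Phi> w\<gamma> assms(1) weyl_root by (simp add: inversions_def weyl_neg neg_in_pos_iff)
  ultimately show ?thesis
    by (metis Diff_subset card_Diff1_less card_inj_on_le finite_Diff finite_inversions order_le_less_trans)
qed

lemma inversions_inv:
  assumes "w \<in> W"
  shows "card (inversions (inv w)) = card (inversions w)"
proof -
  have "bij_betw (\<lambda>\<gamma>. - w \<gamma>) (inversions w) (inversions (inv w))"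
  proof (rule bij_betw_byWitness[where f' = "\<lambda>\<gamma>. - inv w \<gamma>"])
    show "(\<lambda>\<gamma>. - w \<gamma>) ` inversions w \<subseteq> inversions (inv w)"
      "(\<lambda>\<gamma>. - inv w \<gamma>) ` inversions (inv w) \<subseteq> inversions w"
      using assms pos_in_roots weyl_root neg_in_pos_iff by (auto simp: inversions_def weyl_neg)
  qed (simp_all add: assms weyl_neg)
  then show ?thesis by (simp add: bij_betw_same_card)
qed

definition word :: "'x list \<Rightarrow> 'x \<Rightarrow> 'x" where
  "word \<alpha>s = foldr (\<lambda>\<alpha> v. \<sigma> \<alpha> \<circ> v) \<alpha>s id"

lemma word_Nil [simp]: "word [] = id"
  and word_Cons [simp]: "word (\<alpha> # \<alpha>s) = \<sigma> \<alpha> \<circ> word \<alpha>s"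
  by (simp_all add: word_def)

lemma word_append: "word (\<alpha>s @ \<beta>s) = word \<alpha>s \<circ> word \<beta>s"
  by (induction \<alpha>s) (simp_all add: comp_assoc)

lemma word_in_weyl: "set \<alpha>s \<subseteq> \<Delta> \<Longrightarrow> word \<alpha>s \<in> W"
  by (induction \<alpha>s) (simp_all add: weyl_id weyl_refl)

text \<open>Since \<beta> has positive norm and is a sum of simple roots, some simple \<alpha> has
  positive product with it. Then \<open>\<sigma> \<alpha> \<beta>\<close> is a lower positive root,
  and \<open>\<sigma> \<beta>\<close> is conjugate to its reflection by
  \<open>\<sigma> \<alpha>\<close>.\<close>

lemma refl_word:
  assumes "\<beta> \<in> P"
  shows "\<exists>\<alpha>s. set \<alpha>s \<subseteq> \<Delta> \<and> \<sigma> \<beta> = word \<alpha>s"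
  using assms
proof (induction "height \<beta>" arbitrary: \<beta> rule: less_induct)
  case less
  show ?case
  proof (cases "\<beta> \<in> \<Delta>")
    case True
    then show ?thesis by (intro exI[of _ "[\<beta>]"]) simp
  next
    case False
    have \<beta>: "\<beta> \<in> \<Phi>" using less.prems pos_in_roots by blast
    obtain as where as: "set as \<subseteq> \<Delta>" "\<beta> = sum_list as"
      using pos_sum_simple less.prems by blast
    have "form \<beta> (sum_list xs) = (\<Sum>a\<leftarrow>xs. form \<beta> a)" for xs
      by (induction xs) (simp_all add: form_linear_right)
    then have "(\<Sum>a\<leftarrow>as. - form \<beta> a) < 0"
      using form_pos[OF \<beta>] as(2) uminus_sum_list_map[of "form \<beta>" as] by (simp add: comp_def)
    then obtain \<alpha> where \<alpha>: "\<alpha> \<in> set as" "form \<beta> \<alpha> > 0"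
      using sum_list_nonneg[of "map (\<lambda>a. - form \<beta> a) as"] by force
    then have \<alpha>\<Delta>: "\<alpha> \<in> \<Delta>" "\<alpha> \<in> \<Phi>" using as by auto
    let ?\<gamma> = "\<sigma> \<alpha> \<beta>" and ?n = "coroot R \<alpha> \<beta>"
    have \<gamma>: "?\<gamma> \<in> P" using refl_simple_pos \<alpha>\<Delta> less.prems False by blast
    have "?n * form \<alpha> \<alpha> > 0"
      using coroot_form[OF \<alpha>\<Delta>(2)] \<alpha>(2) by (simp add: form_commute)
    then have "?n > 0" using form_pos[OF \<alpha>\<Delta>(2)] by (simp add: zero_less_mult_iff)
    have "\<beta> - ?\<gamma> = zmult R (int (nat ?n)) \<alpha>"
      using \<open>?n > 0\<close> by (simp add: reflection_def)
    then have "\<beta> - ?\<gamma> \<in> cone"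
      using cone_scale cone_pos simple_in_pos \<alpha>\<Delta> by metis
    moreover have "\<beta> \<noteq> ?\<gamma>"
      using \<open>?n > 0\<close> zmult_eq_0[of ?n \<alpha>] root_nonzero[OF \<alpha>\<Delta>(2)] by (auto simp: reflection_def)
    ultimately have "height ?\<gamma> < height \<beta>"
      using height_less less.prems by blast
    then obtain bs where "set bs \<subseteq> \<Delta>" "\<sigma> ?\<gamma> = word bs"
      using less.hyps \<gamma> by blast
    moreover have "\<sigma> \<beta> = \<sigma> \<alpha> \<circ> \<sigma> ?\<gamma> \<circ> \<sigma> \<alpha>"
      using refl_conj[of "\<sigma> \<alpha>" \<beta>] \<alpha>\<Delta> \<beta> by (simp add: comp_assoc)
    ultimately show ?thesis
      using \<alpha>\<Delta> by (intro exI[of _ "[\<alpha>] @ bs @ [\<alpha>]"]) (simp add: word_append comp_assoc)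
  qed
qed

lemma weyl_word: "w \<in> W \<Longrightarrow> \<exists>\<alpha>s. set \<alpha>s \<subseteq> \<Delta> \<and> w = word \<alpha>s"
proof (induction rule: weyl_induct)
  case id
  show ?case by (intro exI[of _ "[]"]) simp
next
  case (refl \<alpha> w)
  then obtain xs ys where "set xs \<subseteq> \<Delta>" "\<sigma> \<alpha> = word xs" "set ys \<subseteq> \<Delta>" "w = word ys"
    using refl_word refl_pos_ex by metis
  then show ?case by (intro exI[of _ "xs @ ys"]) (simp add: word_append)
qed

lemma len_word_le: "set \<alpha>s \<subseteq> \<Delta> \<Longrightarrow> len R (word \<alpha>s) \<le> length \<alpha>s"
  unfolding len_def word_def by (rule Least_le) blast

lemma reduced_word:
  assumes "w \<in> W"
  obtains \<alpha>s where "set \<alpha>s \<subseteq> \<Delta>" "w = word \<alpha>s" "length \<alpha>s = len R w"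
proof -
  have "\<exists>n \<alpha>s. length \<alpha>s = n \<and> set \<alpha>s \<subseteq> \<Delta> \<and> w = word \<alpha>s"
    using weyl_word[OF assms] unfolding word_def by blast
  from LeastI_ex[OF this] show ?thesis
    using that unfolding len_def word_def by blast
qed

text \<open>Apply the letters to \<alpha> from the right. The letter that first makes the root
  negative must equal that root, and moving \<open>\<sigma> \<alpha>\<close> leftwards up to it
  cancels this letter.\<close>

lemma word_exchange:
  assumes "set \<alpha>s \<subseteq> \<Delta>" and "\<alpha> \<in> \<Delta>" and "word \<alpha>s \<alpha> \<notin> P"
  shows "\<exists>\<beta>s. set \<beta>s \<subseteq> \<Delta> \<and> Suc (length \<beta>s) = length \<alpha>s \<and> word \<alpha>s \<circ> \<sigma> \<alpha> = word \<beta>s"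
  using assms(1,3)
proof (induction \<alpha>s)
  case Nil
  then show ?case using simple_in_pos assms(2) by simp
next
  case (Cons a as)
  show ?case
  proof (cases "word as \<alpha> \<in> P")
    case True
    then have "word as \<alpha> = a"
      using Cons.prems refl_simple_pos[of a "word as \<alpha>"] by auto
    then have "\<sigma> a \<circ> word as = word as \<circ> \<sigma> \<alpha>"
      using refl_conj word_in_weyl Cons.prems(1) assms(2) simple_in_roots by fastforce
    then show ?thesis
      using Cons.prems(1) assms(2) by (intro exI[of _ as]) simp
  next
    case False
    moreover have "set as \<subseteq> \<Delta>" using Cons.prems(1) by simp
    ultimately obtain bs
      where "set bs \<subseteq> \<Delta>" "Suc (length bs) = length as" "word as \<circ> \<sigma> \<alpha> = word bs"
      using Cons.IH by blast
    then show ?thesis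
      using Cons.prems(1) by (intro exI[of _ "a # bs"]) (simp add: fun_eq_iff)
  qed
qed

text \<open>Prefixes of a reduced word are reduced, and each further letter adds one inversion:
  otherwise the exchange property would shorten the word. From here on, lengths are compared through
  signs of roots.\<close>

lemma len_eq_inversions:
  assumes "w \<in> W"
  shows "len R w = card (inversions w)"
proof -
  have "card (inversions (word \<alpha>s)) = length \<alpha>s"
    if "set \<alpha>s \<subseteq> \<Delta>" "len R (word \<alpha>s) = length \<alpha>s" for \<alpha>s
    using that
  proof (induction \<alpha>s rule: rev_induct)
    case Nil
    then show ?case by (simp add: inversions_def)
  next
    case (snoc \<alpha> \<alpha>s)
    have len: "len R (word \<alpha>s \<circ> \<sigma> \<alpha>) = Suc (length \<alpha>s)"
      using snoc.prems(2) by (simp add: word_append comp_def)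
    obtain \<beta>s where \<beta>s: "set \<beta>s \<subseteq> \<Delta>" "word \<alpha>s = word \<beta>s" "length \<beta>s = len R (word \<alpha>s)"
      using reduced_word[OF word_in_weyl[of \<alpha>s]] snoc.prems by auto
    then have "length \<alpha>s + 1 \<le> length \<beta>s + 1"
      using len_word_le[of "\<beta>s @ [\<alpha>]"] snoc.prems(1) len by (simp add: word_append)
    then have red: "len R (word \<alpha>s) = length \<alpha>s"
      using \<beta>s len_word_le[of \<alpha>s] snoc.prems by simp
    have "word \<alpha>s \<alpha> \<in> P"
    proof (rule ccontr)
      assume "word \<alpha>s \<alpha> \<notin> P"
      then obtain bs where "set bs \<subseteq> \<Delta>" "Suc (length bs) = length \<alpha>s" "word \<alpha>s \<circ> \<sigma> \<alpha> = word bs"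
        using word_exchange[of \<alpha>s \<alpha>] snoc.prems by auto
      then show False
        using len_word_le[of bs] len by simp
    qed
    then have "card (inversions (word (\<alpha>s @ [\<alpha>]))) = length (\<alpha>s @ [\<alpha>])"
      using snoc.IH snoc.prems(1) red inversions_refl_right[of "word \<alpha>s" \<alpha>]
      by (simp add: word_append word_in_weyl)
    then show ?case .
  qed
  then show ?thesis
    using reduced_word[OF assms] by metis
qed

lemma len_id [simp]: "len R id = 0"
  using len_word_le[of "[]"] by simp

lemma len_eq_0: "w \<in> W \<Longrightarrow> len R w = 0 \<Longrightarrow> w = id"
  by (metis word_Nil length_0_conv reduced_word)

lemma len_inv: "w \<in> W \<Longrightarrow> len R (inv w) = len R w"
  by (simp add: len_eq_inversions inversions_inv)

lemma len_refl_right: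
  assumes "w \<in> W" and "\<alpha> \<in> \<Delta>"
  shows "w \<alpha> \<in> P \<Longrightarrow> len R (w \<circ> \<sigma> \<alpha>) = Suc (len R w)"
    and "w \<alpha> \<notin> P \<Longrightarrow> len R w = Suc (len R (w \<circ> \<sigma> \<alpha>))"
proof -
  show "w \<alpha> \<in> P \<Longrightarrow> len R (w \<circ> \<sigma> \<alpha>) = Suc (len R w)"
    using assms by (simp add: len_eq_inversions inversions_refl_right)
  show "len R w = Suc (len R (w \<circ> \<sigma> \<alpha>))" if "w \<alpha> \<notin> P"
    using inversions_refl_right[of "w \<circ> \<sigma> \<alpha>" \<alpha>] assms that weyl_root
    by (simp add: len_eq_inversions weyl_neg neg_in_pos_iff)
qed

lemma len_simple_refl: "\<alpha> \<in> \<Delta> \<Longrightarrow> len R (\<sigma> \<alpha>) = Suc 0"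
  using len_refl_right(1)[OF weyl_id] by (simp add: simple_in_pos)

lemma len_refl_left:
  assumes "w \<in> W" and "\<alpha> \<in> \<Delta>"
  shows "inv w \<alpha> \<in> P \<Longrightarrow> len R (\<sigma> \<alpha> \<circ> w) = Suc (len R w)"
    and "inv w \<alpha> \<notin> P \<Longrightarrow> len R w = Suc (len R (\<sigma> \<alpha> \<circ> w))"
  using len_refl_right[of "inv w" \<alpha>] len_inv[of w] len_inv[of "\<sigma> \<alpha> \<circ> w"] assms
  by (simp_all add: inv_comp_weyl)

lemma len_refl_left_cases:
  assumes "w \<in> W" and "\<alpha> \<in> \<Delta>"
  obtains "len R (\<sigma> \<alpha> \<circ> w) = Suc (len R w)" | "len R w = Suc (len R (\<sigma> \<alpha> \<circ> w))"
  using len_refl_left[OF assms] by blast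

text \<open>\<open>inversions_less_refl\<close> gives one direction. If \<open>inv w \<beta>\<close>
  is negative, the same direction applies to \<open>\<sigma> \<beta> \<circ> w\<close> and shows
  that the length drops.\<close>

lemma len_refl_less_iff:
  assumes "w \<in> W" and "\<beta> \<in> P"
  shows "len R w < len R (\<sigma> \<beta> \<circ> w) \<longleftrightarrow> inv w \<beta> \<in> P"
proof -
  have \<beta>: "\<beta> \<in> \<Phi>" using assms(2) pos_in_roots by blast
  have *: "len R u < len R (\<sigma> \<beta> \<circ> u)" if "u \<in> W" "inv u \<beta> \<in> P" for u
    using inversions_less_refl[of "inv u" \<beta>] inversions_inv[of u] inversions_inv[of "\<sigma> \<beta> \<circ> u"]
      that assms(2) \<beta> by (simp add: len_eq_inversions inv_comp_weyl)
  have "inv (\<sigma> \<beta> \<circ> w) \<beta> \<in> P" if "inv w \<beta> \<notin> P"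
    using that assms(1) \<beta> weyl_root by (simp add: inv_comp_weyl weyl_neg neg_in_pos_iff)
  then show ?thesis
    using *[of w] *[of "\<sigma> \<beta> \<circ> w"] assms(1) \<beta> by force
qed

lemma weyl_len_induct [consumes 1, case_names id refl]:
  assumes "w \<in> W" and "Q id"
    and "\<And>\<alpha> w. \<alpha> \<in> \<Delta> \<Longrightarrow> w \<in> W \<Longrightarrow> len R (\<sigma> \<alpha> \<circ> w) = Suc (len R w) \<Longrightarrow> Q w \<Longrightarrow> Q (\<sigma> \<alpha> \<circ> w)"
  shows "Q w"
  using assms(1)
proof (induction "len R w" arbitrary: w)
  case 0
  then show ?case using len_eq_0 assms(2) by metis
next
  case (Suc n)
  obtain \<alpha>s where \<alpha>s: "set \<alpha>s \<subseteq> \<Delta>" "w = word \<alpha>s" "length \<alpha>s = len R w"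
    using reduced_word Suc.prems by blast
  then obtain \<alpha> as where as: "\<alpha>s = \<alpha> # as" "\<alpha> \<in> \<Delta>" "set as \<subseteq> \<Delta>"
    using Suc.hyps(2) by (cases \<alpha>s) auto
  have u: "word as \<in> W" "w = \<sigma> \<alpha> \<circ> word as"
    using as \<alpha>s by (simp_all add: word_in_weyl)
  moreover have "len R w = Suc (len R (word as))"
    using len_word_le[of as] as \<alpha>s u by (auto elim: len_refl_left_cases[of "word as" \<alpha>])
  ultimately show ?case
    using assms(3)[of \<alpha> "word as"] Suc as by simp
qed

lemma left_descent_ex:
  assumes "w \<in> W" and "w \<noteq> id"
  obtains \<alpha> where "\<alpha> \<in> \<Delta>" "len R w = Suc (len R (\<sigma> \<alpha> \<circ> w))"
  using assms
  by (induction rule: weyl_len_induct) simp_all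

lemma finite_weyl: "finite W"
proof (rule finite_subset)
  show "W \<subseteq> word ` {\<alpha>s. set \<alpha>s \<subseteq> \<Delta> \<and> length \<alpha>s \<le> card P}"
  proof
    fix w assume w: "w \<in> W"
    have "len R w \<le> card P"
      using w finite_pos by (auto simp: len_eq_inversions inversions_def intro: card_mono)
    then show "w \<in> word ` {\<alpha>s. set \<alpha>s \<subseteq> \<Delta> \<and> length \<alpha>s \<le> card P}"
      using reduced_word[OF w] by (metis (mono_tags, lifting) image_eqI mem_Collect_eq)
  qed
  have "finite \<Delta>"
    by (rule finite_subset[OF _ finite_pos]) (auto simp: simple_in_pos)
  then show "finite (word ` {\<alpha>s. set \<alpha>s \<subseteq> \<Delta> \<and> length \<alpha>s \<le> card P})"
    by (simp add: finite_lists_length_le)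
qed

section \<open>The longest element\<close>

abbreviation w\<^sub>0 :: "'x \<Rightarrow> 'x" where "w\<^sub>0 \<equiv> longest R"

lemma longest_in_weyl [simp]: "w\<^sub>0 \<in> W"
  and len_le_longest: "w \<in> W \<Longrightarrow> len R w \<le> len R w\<^sub>0"
proof -
  have b: "\<forall>w. w \<in> W \<longrightarrow> len R w < Suc (Max (len R ` W))"
    using finite_weyl by (simp add: le_imp_less_Suc)
  show "w\<^sub>0 \<in> W" "w \<in> W \<Longrightarrow> len R w \<le> len R w\<^sub>0"
    using arg_max_nat_lemma[OF weyl_id b] unfolding longest_def by auto
qed

text \<open>Maximal length excludes right ascents, so simple roots become negative; all positive
  roots follow because they are sums of simple ones.\<close>

lemma longest_pos: "\<beta> \<in> P \<Longrightarrow> - w\<^sub>0 \<beta> \<in> P"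
proof -
  assume \<beta>: "\<beta> \<in> P"
  have "w\<^sub>0 \<alpha> \<notin> P" if "\<alpha> \<in> \<Delta>" for \<alpha>
    using len_refl_right(1)[OF longest_in_weyl that] len_le_longest[of "w\<^sub>0 \<circ> \<sigma> \<alpha>"] that by force
  then have neg: "- w\<^sub>0 \<alpha> \<in> P" if "\<alpha> \<in> \<Delta>" for \<alpha>
    using that by (simp add: neg_in_pos_iff weyl_root)
  obtain \<alpha>s where \<alpha>s: "set \<alpha>s \<subseteq> \<Delta>" "\<beta> = sum_list \<alpha>s"
    using pos_sum_simple \<beta> by blast
  then have "- w\<^sub>0 \<beta> = sum_list (map (\<lambda>\<alpha>. - w\<^sub>0 \<alpha>) \<alpha>s)" "set (map (\<lambda>\<alpha>. - w\<^sub>0 \<alpha>) \<alpha>s) \<subseteq> P"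
    using neg by (auto simp: weyl_sum_list uminus_sum_list_map comp_def)
  then have "- w\<^sub>0 \<beta> \<in> cone" unfolding cone_def by blast
  then show ?thesis using root_in_cone neg_in_roots weyl_root pos_in_roots[OF \<beta>] by simp
qed

lemma longest_pos_iff: "\<beta> \<in> \<Phi> \<Longrightarrow> w\<^sub>0 \<beta> \<in> P \<longleftrightarrow> \<beta> \<notin> P"
  using longest_pos[of \<beta>] longest_pos[of "- \<beta>"] neg_in_pos_iff weyl_root[OF longest_in_weyl]
  by (auto simp: weyl_neg)

lemma longest_involution [simp]: "w\<^sub>0 \<circ> w\<^sub>0 = id"
proof (rule len_eq_0)
  have "inversions (w\<^sub>0 \<circ> w\<^sub>0) = {}"
    using longest_pos_iff weyl_root[OF longest_in_weyl] pos_in_roots by (auto simp: inversions_def)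
  then show "len R (w\<^sub>0 \<circ> w\<^sub>0) = 0" by (simp add: len_eq_inversions)
qed simp

lemma longest_apply [simp]: "w\<^sub>0 (w\<^sub>0 x) = x"
  using longest_involution by (metis comp_apply id_apply)

lemma longest_comp [simp]: "w\<^sub>0 \<circ> (w\<^sub>0 \<circ> w) = w"
  by (simp add: fun_eq_iff)

lemma inv_longest [simp]: "inv w\<^sub>0 = w\<^sub>0"
  by (rule inv_equality) simp_all

lemma len_longest_comp:
  assumes "w \<in> W"
  shows "len R (w\<^sub>0 \<circ> w) + len R w = card P"
proof -
  have "inversions (w\<^sub>0 \<circ> w) = P - inversions w"
    using assms weyl_root pos_in_roots longest_pos_iff by (auto simp: inversions_def)
  moreover have "card (inversions w) \<le> card P"
    using finite_pos by (auto simp: inversions_def intro: card_mono)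
  moreover have "inversions w \<subseteq> P" by (auto simp: inversions_def)
  ultimately show ?thesis
    using assms by (simp add: len_eq_inversions card_Diff_subset)
qed

text \<open>The map sending \<alpha> to \<open>- w\<^sub>0 \<alpha>\<close> permutes the positive
  roots additively, so it preserves indecomposability. Conjugation by \<open>w\<^sub>0\<close> thus
  permutes the simple reflections, see \<open>refl_longest\<close>.\<close>

lemma longest_simple:
  assumes "\<alpha> \<in> \<Delta>"
  shows "- w\<^sub>0 \<alpha> \<in> \<Delta>"
proof -
  have "\<not> (\<beta> \<in> P \<and> \<gamma> \<in> P \<and> - w\<^sub>0 \<alpha> = \<beta> + \<gamma>)" for \<beta> \<gamma>
  proof
    assume *: "\<beta> \<in> P \<and> \<gamma> \<in> P \<and> - w\<^sub>0 \<alpha> = \<beta> + \<gamma>"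
    then have "\<alpha> = - w\<^sub>0 \<beta> + - w\<^sub>0 \<gamma>"
      using weyl_add[OF longest_in_weyl, of \<beta> \<gamma>] weyl_neg[OF longest_in_weyl, of "w\<^sub>0 \<alpha>"]
      by (metis longest_apply minus_add_distrib minus_minus)
    then show False using * assms longest_pos unfolding simple_roots_def by blast
  qed
  then show ?thesis
    using longest_pos simple_in_pos assms unfolding simple_roots_def[of R] by blast
qed

lemma refl_longest: "\<alpha> \<in> \<Delta> \<Longrightarrow> \<sigma> (- w\<^sub>0 \<alpha>) \<circ> w\<^sub>0 = w\<^sub>0 \<circ> \<sigma> \<alpha>"
  by (simp add: refl_neg weyl_root refl_conj)

section \<open>The Bruhat order\<close>

abbreviation bruhat_le :: "('x \<Rightarrow> 'x) \<Rightarrow> ('x \<Rightarrow> 'x) \<Rightarrow> bool" (infix "\<preceq>" 50) where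
  "u \<preceq> v \<equiv> bruhat R u v"

lemma bruhat_refl [simp]: "u \<preceq> u"
  by (simp add: bruhat_def)

lemma bruhat_trans: "u \<preceq> v \<Longrightarrow> v \<preceq> w \<Longrightarrow> u \<preceq> w"
  unfolding bruhat_def by (rule rtranclp_trans)

lemma bruhat_reflection:
  assumes "u \<in> W" and "\<beta> \<in> \<Phi>" and "len R u < len R (\<sigma> \<beta> \<circ> u)"
  shows "u \<preceq> \<sigma> \<beta> \<circ> u"
proof -
  have "\<sigma> \<beta> \<circ> u = u \<circ> \<sigma> (inv u \<beta>)" "inv u \<beta> \<in> \<Phi>"
    using assms by (simp_all add: refl_conj_inv weyl_root)
  then show ?thesis
    using assms(3) unfolding bruhat_def by (intro r_into_rtranclp) auto
qed

lemma bruhat_induct [consumes 2, case_names base step]: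
  assumes "u \<preceq> v" and "u \<in> W" and "Q u"
    and "\<And>\<beta> w. w \<in> W \<Longrightarrow> u \<preceq> w \<Longrightarrow> \<beta> \<in> P \<Longrightarrow> inv w \<beta> \<in> P \<Longrightarrow> Q w \<Longrightarrow> Q (\<sigma> \<beta> \<circ> w)"
  shows "v \<in> W \<and> Q v"
  using assms(1) unfolding bruhat_def
proof (induction rule: rtranclp_induct)
  case base
  then show ?case using assms by simp
next
  case (step w w')
  then obtain \<alpha> where \<alpha>: "\<alpha> \<in> \<Phi>" "w' = w \<circ> \<sigma> \<alpha>" "len R w < len R w'" by blast
  have w: "w \<in> W" using step by blast
  obtain \<beta> where \<beta>: "\<beta> \<in> P" "\<sigma> (w \<alpha>) = \<sigma> \<beta>"
    using refl_pos_ex weyl_root[OF w \<alpha>(1)] by blast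
  then have w': "w' = \<sigma> \<beta> \<circ> w"
    using refl_conj[OF w \<alpha>(1)] \<alpha>(2) by simp
  moreover have "inv w \<beta> \<in> P"
    using \<alpha>(3) \<beta>(1) w len_refl_less_iff unfolding w' by blast
  moreover have "u \<preceq> w" using step by (simp add: bruhat_def)
  ultimately have "Q (\<sigma> \<beta> \<circ> w)"
    using assms(4) w step.IH \<beta>(1) by blast
  moreover have "w' \<in> W" using w \<alpha> by simp
  ultimately show ?case unfolding w' by blast
qed

lemma bruhat_in_weyl: "u \<preceq> v \<Longrightarrow> u \<in> W \<Longrightarrow> v \<in> W"
  using bruhat_induct[of u v "\<lambda>_. True"] by blast

lemma bruhat_len:
  assumes "u \<preceq> v"
  shows "u = v \<or> len R u < len R v"
  using assms unfolding bruhat_def by (induction rule: rtranclp_induct) auto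

text \<open>Left multiplication by a simple reflection \<open>\<sigma> \<alpha>\<close> maps the edge from \<open>w\<close> to \<open>\<sigma> \<beta> \<circ> w\<close> of the Bruhat
  graph to an edge, except when \<open>\<beta> = \<alpha>\<close>.\<close>

lemma bruhat_edge_refl:
  assumes "w \<in> W" and \<alpha>: "\<alpha> \<in> \<Delta>" and \<beta>: "\<beta> \<in> P" "inv w \<beta> \<in> P" "\<beta> \<noteq> \<alpha>"
  shows "\<sigma> \<alpha> \<circ> w \<preceq> \<sigma> \<alpha> \<circ> (\<sigma> \<beta> \<circ> w)"
proof -
  have s: "\<sigma> \<alpha> \<circ> w \<in> W" "\<sigma> \<alpha> \<beta> \<in> P" "\<sigma> \<alpha> \<beta> \<in> \<Phi>" "\<beta> \<in> \<Phi>"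
    using assms refl_simple_pos pos_in_roots by auto
  then have "len R (\<sigma> \<alpha> \<circ> w) < len R (\<sigma> (\<sigma> \<alpha> \<beta>) \<circ> (\<sigma> \<alpha> \<circ> w))"
    using len_refl_less_iff[of "\<sigma> \<alpha> \<circ> w" "\<sigma> \<alpha> \<beta>"] assms by (simp add: inv_comp_weyl)
  moreover have "\<sigma> (\<sigma> \<alpha> \<beta>) \<circ> (\<sigma> \<alpha> \<circ> w) = \<sigma> \<alpha> \<circ> (\<sigma> \<beta> \<circ> w)"
    using refl_conj[of "\<sigma> \<alpha>" \<beta>] s(4) \<alpha> by (simp flip: comp_assoc)
  ultimately show ?thesis
    using bruhat_reflection[OF s(1,3)] by simp
qed

lemma bruhat_up: "w \<in> W \<Longrightarrow> \<alpha> \<in> \<Delta> \<Longrightarrow> len R w < len R (\<sigma> \<alpha> \<circ> w) \<Longrightarrow> w \<preceq> \<sigma> \<alpha> \<circ> w"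
  by (simp add: bruhat_reflection)

lemma bruhat_down: "w \<in> W \<Longrightarrow> \<alpha> \<in> \<Delta> \<Longrightarrow> len R (\<sigma> \<alpha> \<circ> w) < len R w \<Longrightarrow> \<sigma> \<alpha> \<circ> w \<preceq> w"
  using bruhat_up[of "\<sigma> \<alpha> \<circ> w" \<alpha>] by simp

text \<open>The lifting property before lengths are compared. Along a chain from \<open>u\<close> to
  \<open>v\<close> each edge is carried over by \<open>bruhat_edge_refl\<close>, except an edge with
  \<beta> = \<alpha>; there \<open>\<sigma> \<alpha>\<close> swaps the two ends, which swaps the two
  alternatives.\<close>

lemma bruhat_refl_lower:
  assumes "u \<preceq> v" and "u \<in> W" and "\<alpha> \<in> \<Delta>"
  shows "\<sigma> \<alpha> \<circ> u \<preceq> v \<or> \<sigma> \<alpha> \<circ> u \<preceq> \<sigma> \<alpha> \<circ> v"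
proof -
  have "v \<in> W \<and> (\<sigma> \<alpha> \<circ> u \<preceq> v \<or> \<sigma> \<alpha> \<circ> u \<preceq> \<sigma> \<alpha> \<circ> v)"
    using assms(1,2)
  proof (induction rule: bruhat_induct)
    case base
    show "\<sigma> \<alpha> \<circ> u \<preceq> u \<or> \<sigma> \<alpha> \<circ> u \<preceq> \<sigma> \<alpha> \<circ> u" by simp
  next
    case (step \<beta> w)
    have IH: "\<sigma> \<alpha> \<circ> u \<preceq> w \<or> \<sigma> \<alpha> \<circ> u \<preceq> \<sigma> \<alpha> \<circ> w"
      using step(5) .
    have "w \<preceq> \<sigma> \<beta> \<circ> w"
      using step(1,3,4) len_refl_less_iff bruhat_reflection pos_in_roots by blast
    show "\<sigma> \<alpha> \<circ> u \<preceq> \<sigma> \<beta> \<circ> w \<or> \<sigma> \<alpha> \<circ> u \<preceq> \<sigma> \<alpha> \<circ> (\<sigma> \<beta> \<circ> w)"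
    proof (cases "\<beta> = \<alpha>")
      case True
      then show ?thesis
        using IH \<open>w \<preceq> \<sigma> \<beta> \<circ> w\<close> assms(3) bruhat_trans by auto
    next
      case False
      then show ?thesis
        using IH \<open>w \<preceq> \<sigma> \<beta> \<circ> w\<close> bruhat_edge_refl[OF step(1) assms(3) step(3,4)] bruhat_trans
        by blast
    qed
  qed
  then show ?thesis by blast
qed

lemma bruhat_refl_upper:
  assumes "u \<preceq> v" and "u \<in> W" and "\<alpha> \<in> \<Delta>"
  shows "u \<preceq> \<sigma> \<alpha> \<circ> v \<or> \<sigma> \<alpha> \<circ> u \<preceq> \<sigma> \<alpha> \<circ> v"
proof -
  have "v \<in> W \<and> (u \<preceq> \<sigma> \<alpha> \<circ> v \<or> \<sigma> \<alpha> \<circ> u \<preceq> \<sigma> \<alpha> \<circ> v)"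
    using assms(1,2)
  proof (induction rule: bruhat_induct)
    case base
    show "u \<preceq> \<sigma> \<alpha> \<circ> u \<or> \<sigma> \<alpha> \<circ> u \<preceq> \<sigma> \<alpha> \<circ> u" by simp
  next
    case (step \<beta> w)
    show "u \<preceq> \<sigma> \<alpha> \<circ> (\<sigma> \<beta> \<circ> w) \<or> \<sigma> \<alpha> \<circ> u \<preceq> \<sigma> \<alpha> \<circ> (\<sigma> \<beta> \<circ> w)"
    proof (cases "\<beta> = \<alpha>")
      case True
      then show ?thesis using step(2) assms(3) by simp
    next
      case False
      then show ?thesis
        using step(5) bruhat_edge_refl[OF step(1) assms(3) step(3,4)] bruhat_trans by blast
    qed
  qed
  then show ?thesis by blast
qed

lemma bruhat_lift_lower:
  assumes "u \<preceq> v" "u \<in> W" "\<alpha> \<in> \<Delta>" "len R (\<sigma> \<alpha> \<circ> v) < len R v"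
  shows "\<sigma> \<alpha> \<circ> u \<preceq> v"
  using bruhat_refl_lower[OF assms(1-3)] bruhat_down[of v \<alpha>] bruhat_in_weyl bruhat_trans assms
  by blast

lemma bruhat_lift_upper:
  assumes "u \<preceq> v" "u \<in> W" "\<alpha> \<in> \<Delta>" "len R u < len R (\<sigma> \<alpha> \<circ> u)"
  shows "u \<preceq> \<sigma> \<alpha> \<circ> v"
  using bruhat_refl_upper[OF assms(1-3)] bruhat_up[of u \<alpha>] bruhat_trans assms by blast

text \<open>Edges are right multiplications by reflections, which left multiplication by
  \<open>w\<^sub>0\<close> respects, while it complements lengths. So every edge is
  reversed.\<close>

lemma bruhat_longest:
  assumes "u \<preceq> v" and "u \<in> W"
  shows "w\<^sub>0 \<circ> v \<preceq> w\<^sub>0 \<circ> u"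
proof -
  have "v \<in> W \<and> w\<^sub>0 \<circ> v \<preceq> w\<^sub>0 \<circ> u"
    using assms
  proof (induction rule: bruhat_induct)
    case base
    show "w\<^sub>0 \<circ> u \<preceq> w\<^sub>0 \<circ> u" by simp
  next
    case (step \<beta> w)
    let ?\<alpha> = "inv w \<beta>"
    have \<alpha>: "?\<alpha> \<in> \<Phi>" "w \<circ> \<sigma> ?\<alpha> = \<sigma> \<beta> \<circ> w"
      using step by (simp_all add: pos_in_roots refl_conj_inv)
    have "len R w < len R (\<sigma> \<beta> \<circ> w)"
      using step len_refl_less_iff by blast
    then have "len R (w\<^sub>0 \<circ> (\<sigma> \<beta> \<circ> w)) < len R (w\<^sub>0 \<circ> w)"
      using len_longest_comp[of w] len_longest_comp[of "\<sigma> \<beta> \<circ> w"] step(1,3)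
      by (simp add: pos_in_roots)
    moreover have "w\<^sub>0 \<circ> w = w\<^sub>0 \<circ> (\<sigma> \<beta> \<circ> w) \<circ> \<sigma> ?\<alpha>"
      using \<alpha> by (simp flip: \<alpha>(2) comp_assoc)
    ultimately have "w\<^sub>0 \<circ> (\<sigma> \<beta> \<circ> w) \<preceq> w\<^sub>0 \<circ> w"
      using \<alpha>(1) unfolding bruhat_def by (intro r_into_rtranclp) auto
    then show "w\<^sub>0 \<circ> (\<sigma> \<beta> \<circ> w) \<preceq> w\<^sub>0 \<circ> u"
      using step(5) bruhat_trans by blast
  qed
  then show ?thesis by blast
qed

lemma bruhat_longest_iff:
  assumes "u \<in> W" and "v \<in> W"
  shows "w\<^sub>0 \<circ> v \<preceq> w\<^sub>0 \<circ> u \<longleftrightarrow> u \<preceq> v"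
  using bruhat_longest[of u v] bruhat_longest[of "w\<^sub>0 \<circ> v" "w\<^sub>0 \<circ> u"] assms by auto

section \<open>Signs over Bruhat intervals\<close>

definition interval :: "('x \<Rightarrow> 'x) \<Rightarrow> ('x \<Rightarrow> 'x) \<Rightarrow> ('x \<Rightarrow> 'x) set" where
  "interval u v = {y \<in> W. u \<preceq> y \<and> y \<preceq> v}"

lemma finite_interval [simp]: "finite (interval u v)"
  by (simp add: interval_def finite_weyl)

lemma len_refl_parity:
  "w \<in> W \<Longrightarrow> \<alpha> \<in> \<Delta> \<Longrightarrow> (- 1 :: 'b::ring_1) ^ len R (\<sigma> \<alpha> \<circ> w) = - ((- 1) ^ len R w)"
  by (rule len_refl_left_cases[of w \<alpha>]) simp_all

text \<open>By the lifting property \<open>\<sigma> \<alpha>\<close> acts on the interval as an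
  involution that reverses signs.\<close>

lemma interval_sign_sum_lift:
  assumes u: "u \<in> W" and v: "v \<in> W" and \<alpha>: "\<alpha> \<in> \<Delta>"
    and up: "len R u < len R (\<sigma> \<alpha> \<circ> u)" and down: "len R (\<sigma> \<alpha> \<circ> v) < len R v"
  shows "(\<Sum>y\<in>interval u v. (- 1 :: int) ^ len R y) = 0"
proof -
  let ?s = "\<lambda>y. \<sigma> \<alpha> \<circ> y"
  have closed: "?s y \<in> interval u v" if "y \<in> interval u v" for y
  proof -
    have y: "y \<in> W" "u \<preceq> y" "y \<preceq> v" using that by (simp_all add: interval_def)
    then show ?thesis
      using bruhat_lift_lower[of y v \<alpha>] bruhat_lift_upper[of u y \<alpha>] u \<alpha> up down
      by (simp add: interval_def)
  qed
  have "bij_betw ?s (interval u v) (interval u v)"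
    by (rule bij_betw_byWitness[where f' = ?s]) (use closed \<alpha> in auto)
  then have "(\<Sum>y\<in>interval u v. (- 1 :: int) ^ len R y) = (\<Sum>y\<in>interval u v. (- 1) ^ len R (?s y))"
    by (rule sum.reindex_bij_betw[symmetric])
  also have "\<dots> = (\<Sum>y\<in>interval u v. - ((- 1) ^ len R y))"
    using \<alpha> by (intro sum.cong refl len_refl_parity) (auto simp: interval_def)
  finally show ?thesis by (simp add: sum_negf)
qed

text \<open>Verma's theorem on the Moebius function of the Bruhat order. Take a left descent \<open>\<sigma> \<alpha>\<close> of \<open>v\<close>. If
  it is also one of \<open>u\<close>, then the elements of \<open>[\<sigma> \<alpha> \<circ> u, v]\<close> that are not above \<open>u\<close> all lie below
  \<open>\<sigma> \<alpha> \<circ> v\<close>, so that the intervals with upper end \<open>v\<close> are compared with shorter ones.\<close>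

theorem interval_sign_sum:
  assumes "u \<in> W" and "v \<in> W" and "u \<noteq> v"
  shows "(\<Sum>y\<in>interval u v. (- 1 :: int) ^ len R y) = 0"
  using assms
proof (induction "len R v" arbitrary: u v rule: less_induct)
  case less
  show ?case
  proof (cases "u \<preceq> v")
    case False
    then have "interval u v = {}" using bruhat_trans by (auto simp: interval_def)
    then show ?thesis by simp
  next
    case True
    then have "v \<noteq> id" using bruhat_len[of u v] less.prems by auto
    then obtain \<alpha> where \<alpha>: "\<alpha> \<in> \<Delta>" "len R v = Suc (len R (\<sigma> \<alpha> \<circ> v))"
      using left_descent_ex less.prems by blast
    show ?thesis
    proof (cases rule: len_refl_left_cases[OF less.prems(1) \<alpha>(1)])
      case 1
      then show ?thesis using interval_sign_sum_lift less.prems \<alpha> by simp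
    next
      case 2
      let ?su = "\<sigma> \<alpha> \<circ> u" and ?sv = "\<sigma> \<alpha> \<circ> v" and ?f = "\<lambda>y. (- 1 :: int) ^ len R y"
      have W: "?su \<in> W" "?sv \<in> W" using less.prems \<alpha> by simp_all
      have ne: "?su \<noteq> ?sv" using less.prems(3) \<alpha>(1) by (metis refl_comp_cancel simple_in_roots)
      have "u \<noteq> ?sv"
      proof
        assume "u = ?sv"
        with 2 \<alpha> show False by simp
      qed
      have le: "?su \<preceq> u" "?sv \<preceq> v" using bruhat_down 2 \<alpha> less.prems by simp_all
      have sub: "interval u v \<subseteq> interval ?su v" "interval u ?sv \<subseteq> interval ?su ?sv"
        using le bruhat_trans by (auto simp: interval_def)
      have "interval ?su v - interval u v = interval ?su ?sv - interval u ?sv"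
      proof (intro equalityI subsetI)
        fix y assume "y \<in> interval ?su v - interval u v"
        then have y: "y \<in> W" "?su \<preceq> y" "y \<preceq> v" "\<not> u \<preceq> y" by (auto simp: interval_def)
        \<comment> \<open>If \<open>\<sigma> \<alpha>\<close> were a descent of \<open>y\<close>,
          lifting \<open>?su \<preceq> y\<close> would give \<open>u \<preceq> y\<close>.\<close>
        have "len R y < len R (\<sigma> \<alpha> \<circ> y)"
        proof (cases rule: len_refl_left_cases[OF y(1) \<alpha>(1)])
          case 2
          then show ?thesis using bruhat_lift_lower[OF y(2) W(1) \<alpha>(1)] y(4) \<alpha>(1) by simp
        qed simp
        then have "y \<preceq> ?sv" using bruhat_lift_upper y \<alpha>(1) by blast
        then show "y \<in> interval ?su ?sv - interval u ?sv" using y by (simp add: interval_def)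
      next
        fix y assume "y \<in> interval ?su ?sv - interval u ?sv"
        then show "y \<in> interval ?su v - interval u v"
          using le bruhat_trans by (auto simp: interval_def)
      qed
      then have "sum ?f (interval ?su v) - sum ?f (interval u v)
          = sum ?f (interval ?su ?sv) - sum ?f (interval u ?sv)"
        using sub by (metis finite_interval sum_diff)
      moreover have "sum ?f (interval ?su ?sv) = 0" "sum ?f (interval u ?sv) = 0"
        using less.hyps[of ?sv] \<alpha>(2) W less.prems ne \<open>u \<noteq> ?sv\<close> by simp_all
      moreover have "sum ?f (interval ?su v) = 0"
        using interval_sign_sum_lift[OF W(1) less.prems(2) \<alpha>(1)] 2 \<alpha> by simp
      ultimately show ?thesis by simp
    qed
  qed
qed

end

section \<open>The Hecke algebra\<close>

lemma const_minus: "const (- a) = - const a"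
  using const_add[of a "- a"] by (simp add: eq_neg_iff_add_eq_0 add.commute)

lemma bar_0 [simp]: "bar 0 = 0"
  and bar_1 [simp]: "bar 1 = 1"
  using bar_const[of 0] bar_const[of 1] by simp_all

lemma bar_neg_1_power [simp]: "bar ((- 1) ^ n) = (- 1) ^ n"
proof (induction n)
  case (Suc n)
  have "bar (- 1) = - 1"
    using bar_const[of "- 1"] by (simp add: const_minus)
  with Suc show ?case by (simp only: power_Suc bar_mult)
qed simp

lemma bar_sum: "bar (\<Sum>x\<in>A. f x) = (\<Sum>x\<in>A. bar (f x))"
  by (induction A rule: infinite_finite_induct) (simp_all add: bar_add)

context hecke_algebra
begin

lemma qlen_simps [simp]:
  "qlen R id = 1" "w \<in> W \<Longrightarrow> qlen R (inv w) = qlen R w" "qlen R w \<noteq> 0"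
  by (simp_all add: qlen_def len_inv)

lemma qlen_Suc: "len R w = Suc (len R w') \<Longrightarrow> qlen R w = q * qlen R w'"
  by (simp add: qlen_def)

lemma hecke_induct [case_names basis add scale]:
  assumes "\<And>w. w \<in> W \<Longrightarrow> Q (T (inv w))"
    and "\<And>a b. Q a \<Longrightarrow> Q b \<Longrightarrow> Q (a + b)"
    and "\<And>c a. Q a \<Longrightarrow> Q (scale c a)"
  shows "Q h"
proof -
  have T: "Q (T w)" if "w \<in> W" for w
    using assms(1)[of "inv w"] that by simp
  have "h \<in> span (T ` W)" by (simp add: T_span)
  then show ?thesis
  proof (induction rule: span_induct_alt)
    case base
    show ?case using assms(3)[OF T[OF weyl_id], of 0] by simp
  next
    case (step c x y)
    then show ?case using assms(2,3) T by blast
  qed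
qed

lemma T_id: "T id = 1"
proof -
  have "T id * h = h" for h
  proof (induction h rule: hecke_induct)
    case (basis w)
    then show "T id * T (inv w) = T (inv w)"
      using T_mult[of id "inv w"] by (simp add: weyl_id)
  qed (simp_all add: distrib_left flip: scale_mult_right)
  from this[of 1] show ?thesis by simp
qed

lemma T_refl_left:
  assumes "w \<in> W" and "\<alpha> \<in> \<Delta>"
  shows "len R (\<sigma> \<alpha> \<circ> w) = Suc (len R w) \<Longrightarrow> T (\<sigma> \<alpha>) * T w = T (\<sigma> \<alpha> \<circ> w)"
    and "len R w = Suc (len R (\<sigma> \<alpha> \<circ> w)) \<Longrightarrow>
      T (\<sigma> \<alpha>) * T w = scale (q - 1) (T w) + scale q (T (\<sigma> \<alpha> \<circ> w))"
proof -
  have up: "T (\<sigma> \<alpha>) * T w = T (\<sigma> \<alpha> \<circ> w)"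
    if "w \<in> W" "len R (\<sigma> \<alpha> \<circ> w) = Suc (len R w)" for w
    using T_mult[of "\<sigma> \<alpha>" w] that assms(2) by (simp add: len_simple_refl)
  then show "len R (\<sigma> \<alpha> \<circ> w) = Suc (len R w) \<Longrightarrow> T (\<sigma> \<alpha>) * T w = T (\<sigma> \<alpha> \<circ> w)"
    using assms(1) .
  show "T (\<sigma> \<alpha>) * T w = scale (q - 1) (T w) + scale q (T (\<sigma> \<alpha> \<circ> w))"
    if "len R w = Suc (len R (\<sigma> \<alpha> \<circ> w))"
  proof -
    have w: "T w = T (\<sigma> \<alpha>) * T (\<sigma> \<alpha> \<circ> w)"
      using up[of "\<sigma> \<alpha> \<circ> w"] that assms by simp
    have "T (\<sigma> \<alpha>) * T w = T (\<sigma> \<alpha>) * T (\<sigma> \<alpha>) * T (\<sigma> \<alpha> \<circ> w)"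
      unfolding w by (simp add: mult.assoc)
    also have "\<dots> = scale (q - 1) (T w) + scale q (T (\<sigma> \<alpha> \<circ> w))"
      by (simp add: T_quadratic assms(2) distrib_right w flip: scale_mult_left)
    finally show ?thesis .
  qed
qed

text \<open>With \<open>inv w\<close> as index, multiplication on the right in the algebra is
  multiplication on the left in the group, the side on which descents and the lifting property are
  stated.\<close>

lemma T_refl_right:
  assumes "w \<in> W" and "\<alpha> \<in> \<Delta>"
  shows "len R (\<sigma> \<alpha> \<circ> w) = Suc (len R w) \<Longrightarrow> T (inv w) * T (\<sigma> \<alpha>) = T (inv (\<sigma> \<alpha> \<circ> w))"
    and "len R w = Suc (len R (\<sigma> \<alpha> \<circ> w)) \<Longrightarrow>
      T (inv w) * T (\<sigma> \<alpha>) = scale (q - 1) (T (inv w)) + scale q (T (inv (\<sigma> \<alpha> \<circ> w)))"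
proof -
  have up: "T (inv w) * T (\<sigma> \<alpha>) = T (inv (\<sigma> \<alpha> \<circ> w))"
    if "w \<in> W" "len R (\<sigma> \<alpha> \<circ> w) = Suc (len R w)" for w
    using T_mult[of "inv w" "\<sigma> \<alpha>"] len_inv[of "\<sigma> \<alpha> \<circ> w"] that assms(2)
    by (simp add: len_simple_refl len_inv inv_comp_weyl)
  then show "len R (\<sigma> \<alpha> \<circ> w) = Suc (len R w) \<Longrightarrow> T (inv w) * T (\<sigma> \<alpha>) = T (inv (\<sigma> \<alpha> \<circ> w))"
    using assms(1) .
  show "T (inv w) * T (\<sigma> \<alpha>) = scale (q - 1) (T (inv w)) + scale q (T (inv (\<sigma> \<alpha> \<circ> w)))"
    if "len R w = Suc (len R (\<sigma> \<alpha> \<circ> w))"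
  proof -
    have w: "T (inv w) = T (inv (\<sigma> \<alpha> \<circ> w)) * T (\<sigma> \<alpha>)"
      using up[of "\<sigma> \<alpha> \<circ> w"] that assms by simp
    have "T (inv w) * T (\<sigma> \<alpha>) = T (inv (\<sigma> \<alpha> \<circ> w)) * (T (\<sigma> \<alpha>) * T (\<sigma> \<alpha>))"
      unfolding w by (simp add: mult.assoc)
    also have "\<dots> = scale (q - 1) (T (inv w)) + scale q (T (inv (\<sigma> \<alpha> \<circ> w)))"
      by (simp add: T_quadratic assms(2) distrib_left w flip: scale_mult_right)
    finally show ?thesis .
  qed
qed

text \<open>With this normalization \<open>\<tau> h u\<close> is the value of \<open>Lam\<close> at
  \<open>T u * h\<close>, see \<open>Lam_T_mult\<close>.\<close>

definition \<tau> :: "'h \<Rightarrow> ('x \<Rightarrow> 'x) \<Rightarrow> ratfun" where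
  "\<tau> h u = qlen R u * coeffT R scale T h (inv u)"

lemma \<tau>_add: "\<tau> (a + b) u = \<tau> a u + \<tau> b u"
  and \<tau>_scale: "\<tau> (scale c a) u = c * \<tau> a u"
  and \<tau>_sum: "\<tau> (\<Sum>i\<in>I. f i) u = (\<Sum>i\<in>I. \<tau> (f i) u)"
  by (simp_all add: \<tau>_def coeffT_add coeffT_scale coeffT_sum algebra_simps sum_distrib_left)

lemma \<tau>_T: "w \<in> W \<Longrightarrow> u \<in> W \<Longrightarrow> \<tau> (T (inv w)) u = (if u = w then qlen R u else 0)"
  by (simp add: \<tau>_def coeffT_T inv_weyl_eq_iff eq_commute)

lemma refl_eq_iff: "\<alpha> \<in> \<Delta> \<Longrightarrow> \<sigma> \<alpha> \<circ> u = w \<longleftrightarrow> u = \<sigma> \<alpha> \<circ> w"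
  by auto

text \<open>This is the rule for \<open>T (\<sigma> \<alpha>) * T u\<close>, as one expects from
  \<tau> being pairing with \<open>T u\<close> under a trace. It is checked on the basis.\<close>

lemma \<tau>_mult_T_refl:
  assumes "u \<in> W" and \<alpha>: "\<alpha> \<in> \<Delta>"
  shows "\<tau> (h * T (\<sigma> \<alpha>)) u =
    (if len R u < len R (\<sigma> \<alpha> \<circ> u) then \<tau> h (\<sigma> \<alpha> \<circ> u) else (q - 1) * \<tau> h u + q * \<tau> h (\<sigma> \<alpha> \<circ> u))"
proof -
  define u' where "u' = \<sigma> \<alpha> \<circ> u"
  have "\<tau> (h * T (\<sigma> \<alpha>)) u = (if len R u < len R u' then \<tau> h u' else (q - 1) * \<tau> h u + q * \<tau> h u')"
  proof (induction h rule: hecke_induct)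
    case (basis w)
    define w' where "w' = \<sigma> \<alpha> \<circ> w"
    have W: "w' \<in> W" "u' \<in> W" and eq: "u' = w \<longleftrightarrow> u = w'" "u' = w' \<longleftrightarrow> u = w"
      using assms basis by (auto simp: u'_def w'_def dest: arg_cong[of _ _ "\<lambda>x. \<sigma> \<alpha> \<circ> x"])
    have len_eq: "u = w' \<longrightarrow> qlen R u' = qlen R w" using eq(1) by auto
    note simps = W eq \<tau>_T \<tau>_add \<tau>_scale assms(1) basis
    note T_refl = T_refl_right[OF basis \<alpha>, folded w'_def]
    note u_cases = len_refl_left_cases[OF assms, folded u'_def]
    show ?case
    proof (cases rule: len_refl_left_cases[OF basis \<alpha>, folded w'_def])
      case 1
      show ?thesis
      proof (cases rule: u_cases)
        case u: 1
        then have "u \<noteq> w'" using 1 eq by auto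
        then show ?thesis using u by (simp add: T_refl(1)[OF 1] simps)
      next
        case u: 2
        then have "u \<noteq> w" using 1 eq by auto
        then show ?thesis using u qlen_Suc[OF 1] len_eq by (simp add: T_refl(1)[OF 1] simps)
      qed
    next
      case 2
      show ?thesis
      proof (cases rule: u_cases)
        case u: 1
        then have "u \<noteq> w" using 2 eq by auto
        then show ?thesis using u qlen_Suc[OF 2] len_eq by (simp add: T_refl(2)[OF 2] simps)
      next
        case u: 2
        then have "u \<noteq> w'" using 2 eq by auto
        then show ?thesis using u by (simp add: T_refl(2)[OF 2] simps)
      qed
    qed
  qed (auto simp: \<tau>_add \<tau>_scale distrib_right algebra_simps simp flip: scale_mult_left)
  then show ?thesis unfolding u'_def .
qed

section \<open>The functional \<open>Lam\<close> and dual bases\<close>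

lemma Lam_add: "Lam R scale T (a + b) = Lam R scale T a + Lam R scale T b"
  and Lam_scale: "Lam R scale T (scale c a) = c * Lam R scale T a"
  and Lam_sum: "Lam R scale T (\<Sum>i\<in>I. f i) = (\<Sum>i\<in>I. Lam R scale T (f i))"
  by (simp_all add: Lam_def coeffT_add coeffT_scale coeffT_sum)

text \<open>The last factor \<open>T (\<sigma> \<alpha>)\<close> of
  \<open>T (inv (\<sigma> \<alpha> \<circ> y))\<close> is moved onto \<open>T w\<close>. The extra
  term \<open>T w\<close> of the quadratic relation pairs to zero with \<open>T (inv y)\<close>,
  because \<alpha> is a descent of \<open>w\<close> but an ascent of \<open>y\<close>.\<close>

lemma Lam_T_mult_T:
  assumes "y \<in> W" and "w \<in> W"
  shows "Lam R scale T (T (inv y) * T w) = (if w = y then qlen R y else 0)"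
proof -
  have "\<forall>w\<in>W. Lam R scale T (T (inv y) * T w) = (if w = y then qlen R y else 0)"
    using assms(1)
  proof (induction rule: weyl_len_induct)
    case id
    show "\<forall>w\<in>W. Lam R scale T (T (inv id) * T w) = (if w = id then qlen R id else 0)"
      by (simp add: T_id Lam_T)
  next
    case (refl \<alpha> y)
    note IH = refl(4)[rule_format]
    show "\<forall>w\<in>W. Lam R scale T (T (inv (\<sigma> \<alpha> \<circ> y)) * T w) =
        (if w = \<sigma> \<alpha> \<circ> y then qlen R (\<sigma> \<alpha> \<circ> y) else 0)"
    proof
      fix w assume w: "w \<in> W"
      have sw: "\<sigma> \<alpha> \<circ> w \<in> W" using w refl(1) by simp
      have *: "T (inv (\<sigma> \<alpha> \<circ> y)) * T w = T (inv y) * (T (\<sigma> \<alpha>) * T w)"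
        using T_refl_right(1)[OF refl(2,1,3)] by (simp flip: mult.assoc)
      show "Lam R scale T (T (inv (\<sigma> \<alpha> \<circ> y)) * T w) =
        (if w = \<sigma> \<alpha> \<circ> y then qlen R (\<sigma> \<alpha> \<circ> y) else 0)"
      proof (cases rule: len_refl_left_cases[OF w refl(1)])
        case 1
        then have "w \<noteq> \<sigma> \<alpha> \<circ> y" using refl(1,3) by auto
        then show ?thesis
          using 1 IH[OF sw] refl(1) unfolding * by (simp add: T_refl_left w refl_eq_iff)
      next
        case 2
        then have "w \<noteq> y" using refl(3) by auto
        then show ?thesis
          using 2 IH[OF sw] IH[OF w] refl(1) qlen_Suc[OF refl(3)] unfolding *
          by (simp add: T_refl_left w refl_eq_iff distrib_left Lam_add Lam_scale flip: scale_mult_right)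
      qed
    qed
  qed
  then show ?thesis using assms(2) by blast
qed

lemma Lam_T_mult: "x \<in> W \<Longrightarrow> Lam R scale T (T x * h) = \<tau> h x"
proof (induction h rule: hecke_induct)
  case (basis w)
  then show ?case
    using Lam_T_mult_T[of "inv x" "inv w"] by (auto simp: \<tau>_T inv_weyl_eq_iff)
qed (simp_all add: distrib_left Lam_add Lam_scale \<tau>_add \<tau>_scale flip: scale_mult_right)

end

section \<open>The torus action on the structure constants\<close>

definition c_term :: "('x \<Rightarrow> complex) \<Rightarrow> 'x \<Rightarrow> ratfun" where
  "c_term z \<alpha> = const (z \<alpha> / (1 - z \<alpha>))"

context root_datum
begin

lemma act_comp: "w \<in> W \<Longrightarrow> w' \<in> W \<Longrightarrow> act (w \<circ> w') z = act w (act w' z)"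
  by (simp add: act_def inv_comp_weyl fun_eq_iff)

lemma act_regular: "z \<in> regular R \<Longrightarrow> w \<in> W \<Longrightarrow> act w z \<in> regular R"
  using weyl_root[of "inv w"] weyl_add[of "inv w"]
  by (simp add: act_def regular_def torus_def)

lemma c_term_neg:
  assumes "z \<in> regular R" and "\<alpha> \<in> \<Phi>"
  shows "c_term z (- \<alpha>) = - 1 - c_term z \<alpha>"
proof -
  have z: "z (x + y) = z x * z y" "z x \<noteq> 0" "z \<alpha> \<noteq> 1" for x y
    using assms by (auto simp: regular_def torus_def)
  have "z 0 = 1" using z(1)[of 0 0] z(2)[of 0] by simp
  then have "z (- \<alpha>) = 1 / z \<alpha>"
    using z(1)[of \<alpha> "- \<alpha>"] z(2)[of \<alpha>] by (simp add: field_simps)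
  moreover have "1 / t / (1 - 1 / t) = - 1 + - (t / (1 - t))" if "t \<noteq> 0" "t \<noteq> 1" for t :: complex
    using that by (simp add: divide_simps)
  ultimately have "z (- \<alpha>) / (1 - z (- \<alpha>)) = - 1 + - (z \<alpha> / (1 - z \<alpha>))"
    using z by simp
  then show ?thesis
    by (simp only: c_term_def const_add const_minus const_1 diff_conv_add_uminus)
qed

lemma c_term_act_refl:
  assumes "z \<in> regular R" and "w \<in> W" and "\<alpha> \<in> \<Delta>"
  shows "c_term (act (\<sigma> \<alpha> \<circ> w) z) \<alpha> = - 1 - c_term (act w z) \<alpha>"
proof -
  have "act (\<sigma> \<alpha> \<circ> w) z \<alpha> = act w z (- \<alpha>)"
    using assms by (simp add: act_def inv_comp_weyl)
  then show ?thesis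
    using c_term_neg[OF act_regular[OF assms(1,2)], of \<alpha>] assms(3) by (simp add: c_term_def)
qed

lemma c_term_act_longest:
  assumes "z \<in> regular R" and "w \<in> W" and "\<alpha> \<in> \<Delta>"
  shows "c_term (act (w\<^sub>0 \<circ> w) z) (- w\<^sub>0 \<alpha>) = - 1 - c_term (act w z) \<alpha>"
proof -
  have "act (w\<^sub>0 \<circ> w) z (- w\<^sub>0 \<alpha>) = act w z (- \<alpha>)"
    using assms by (simp add: act_def inv_comp_weyl weyl_neg)
  then show ?thesis
    using c_term_neg[OF act_regular[OF assms(1,2)], of \<alpha>] assms(3) by (simp add: c_term_def)
qed

end

section \<open>The elements \<mu> and the recursion for their coordinates\<close>

context mu_family
begin

text \<open>With t = \<open>act w z \<alpha>\<close> the second value is (1 - t/q)(1 - 1/(qt)) / ((1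
  - t)(1 - 1/t)). It is invariant under inversion of t, so both ends of the edge from
  \<open>w\<close> to \<open>\<sigma> \<alpha> \<circ> w\<close> give the same expression.\<close>

definition \<kappa> :: "('x \<Rightarrow> complex) \<Rightarrow> ('x \<Rightarrow> 'x) \<Rightarrow> 'x \<Rightarrow> ratfun" where
  "\<kappa> z w \<alpha> = (if len R w < len R (\<sigma> \<alpha> \<circ> w) then 1
    else inverse q - (1 - inverse q)^2 * c_term (act w z) \<alpha> * (1 + c_term (act w z) \<alpha>))"

lemma mu_simple_mult:
  assumes "z \<in> regular R" and "\<alpha> \<in> \<Delta>"
  shows "\<mu> z (\<sigma> \<alpha>) * \<mu> (act (\<sigma> \<alpha>) z) (\<sigma> \<alpha>) =
    scale (inverse q - (1 - inverse q)^2 * c_term z \<alpha> * (1 + c_term z \<alpha>)) 1"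
proof -
  let ?X = "T (\<sigma> \<alpha>)" and ?a = "inverse q" and ?c = "c_term z \<alpha>"
  let ?d = "(1 - ?a) * ?c" and ?d' = "(1 - ?a) * (- 1 - ?c)"
  have z': "act (\<sigma> \<alpha>) z \<in> regular R" using assms act_regular by simp
  have "c_term (act (\<sigma> \<alpha>) z) \<alpha> = - 1 - ?c"
    using c_term_act_refl[OF assms(1) weyl_id assms(2)] by (simp add: act_def)
  then have "\<mu> z (\<sigma> \<alpha>) * \<mu> (act (\<sigma> \<alpha>) z) (\<sigma> \<alpha>) =
      (scale ?a ?X + scale ?d 1) * (scale ?a ?X + scale ?d' 1)"
    using mu_simple[OF assms] mu_simple[OF z' assms(2)] by (simp flip: c_term_def)
  also have "\<dots> = scale (?a * ?a) (?X * ?X) + scale (?a * ?d' + ?d * ?a) ?X + scale (?d * ?d') 1"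
    by (simp add: distrib_left distrib_right scale_left_distrib scale_right_distrib mult_ac flip: scale_mult_left scale_mult_right)
  also have "\<dots> = scale (?a * ?a * (q - 1) + (?a * ?d' + ?d * ?a)) ?X + scale (?a * ?a * q + ?d * ?d') 1"
    by (simp add: T_quadratic assms(2) scale_right_distrib scale_left_distrib)
  \<comment> \<open>The two values of c add up to -1, which cancels the linear term of the quadratic
    relation.\<close>
  also have "?a * ?a * (q - 1) + (?a * ?d' + ?d * ?a) = 0"
    by (simp add: field_simps)
  also have "?a * ?a * q + ?d * ?d' = ?a - (1 - ?a)^2 * ?c * (1 + ?c)"
    by (simp add: power2_eq_square algebra_simps)
  finally show ?thesis by simp
qed

text \<open>At an ascent this is multiplicativity of \<mu>. At a descent \<open>\<mu> z w\<close>
  ends in a simple factor for the same reflection, and \<open>mu_simple_mult\<close> collapses the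
  two factors.\<close>

lemma mu_mult_refl:
  assumes z: "z \<in> regular R" and w: "w \<in> W" and \<alpha>: "\<alpha> \<in> \<Delta>"
  shows "\<mu> z w * \<mu> (act w z) (\<sigma> \<alpha>) = scale (\<kappa> z w \<alpha>) (\<mu> z (\<sigma> \<alpha> \<circ> w))"
proof -
  have up: "\<mu> z (\<sigma> \<alpha> \<circ> w) = \<mu> z w * \<mu> (act w z) (\<sigma> \<alpha>)"
    if "w \<in> W" "len R (\<sigma> \<alpha> \<circ> w) = Suc (len R w)" for w
    using mu_mult[OF z _ that(1), of "\<sigma> \<alpha>"] that(2) \<alpha> by (simp add: len_simple_refl)
  show ?thesis
  proof (cases rule: len_refl_left_cases[OF w \<alpha>])
    case 1
    then show ?thesis using up[OF w 1] by (simp add: \<kappa>_def)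
  next
    case 2
    let ?w = "\<sigma> \<alpha> \<circ> w"
    let ?y = "act ?w z"
    have y: "?y \<in> regular R" "act (\<sigma> \<alpha>) ?y = act w z"
      using act_regular[OF z] act_comp[of "\<sigma> \<alpha>" ?w z] w \<alpha> by simp_all
    have "\<mu> z w * \<mu> (act w z) (\<sigma> \<alpha>) = \<mu> z ?w * (\<mu> ?y (\<sigma> \<alpha>) * \<mu> (act (\<sigma> \<alpha>) ?y) (\<sigma> \<alpha>))"
      using up[of ?w] 2 w \<alpha> y(2) by (simp add: mult.assoc)
    also have "\<dots> = scale (\<kappa> z w \<alpha>) (\<mu> z ?w)"
      unfolding mu_simple_mult[OF y(1) \<alpha>] c_term_act_refl[OF z w \<alpha>] using 2
      by (simp add: \<kappa>_def algebra_simps flip: scale_mult_right)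
    finally show ?thesis .
  qed
qed

lemma mu_simple_act:
  assumes "z \<in> regular R" and "w \<in> W" and "\<alpha> \<in> \<Delta>"
  shows "\<mu> (act w z) (\<sigma> \<alpha>) =
    scale (inverse q) (T (\<sigma> \<alpha>)) + scale ((1 - inverse q) * c_term (act w z) \<alpha>) 1"
  using mu_simple[OF act_regular[OF assms(1,2)] assms(3)] by (simp add: c_term_def)

lemma mu_mult_T_refl:
  assumes "z \<in> regular R" and "w \<in> W" and "\<alpha> \<in> \<Delta>"
  shows "\<mu> z w * T (\<sigma> \<alpha>) = scale (q * \<kappa> z w \<alpha>) (\<mu> z (\<sigma> \<alpha> \<circ> w))
    - scale ((q - 1) * c_term (act w z) \<alpha>) (\<mu> z w)"
proof -
  have "scale q (\<mu> z w * \<mu> (act w z) (\<sigma> \<alpha>)) =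
      \<mu> z w * T (\<sigma> \<alpha>) + scale (q * ((1 - inverse q) * c_term (act w z) \<alpha>)) (\<mu> z w)"
    unfolding mu_simple_act[OF assms]
    by (simp add: distrib_left scale_right_distrib flip: scale_mult_right)
  moreover have "q * ((1 - inverse q) * c_term (act w z) \<alpha>) = (q - 1) * c_term (act w z) \<alpha>"
    by (simp add: field_simps)
  ultimately show ?thesis
    unfolding mu_mult_refl[OF assms] by simp
qed

definition \<rho> :: "('x \<Rightarrow> complex) \<Rightarrow> ('x \<Rightarrow> 'x) \<Rightarrow> ('x \<Rightarrow> 'x) \<Rightarrow> ratfun" where
  "\<rho> z u v = \<tau> (\<mu> z v) u"

lemma r_coeff_eq: "r_coeff R scale T \<mu> z u v = bar (\<rho> z u v)"
  by (simp add: r_coeff_def \<rho>_def \<tau>_def)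

lemma m_coeff_eq: "m_coeff R scale T \<mu> z u v = (\<Sum>x \<in> {x \<in> W. bruhat R u x}. \<rho> z x v)"
  by (simp add: m_coeff_def psi_def sum_distrib_right Lam_sum Lam_T_mult \<rho>_def)

text \<open>Both sides are coordinates of
  \<open>\<mu> z w * \<mu> (act w z) (\<sigma> \<alpha>)\<close>. With \<kappa> left as a factor, a
  single formula serves ascents and descents of \<open>w\<close>, as
  \<open>\<rho>_longest_refl\<close> requires.\<close>

lemma \<rho>_refl:
  assumes "z \<in> regular R" and "u \<in> W" and "w \<in> W" and "\<alpha> \<in> \<Delta>"
  shows "\<kappa> z w \<alpha> * \<rho> z u (\<sigma> \<alpha> \<circ> w) =
    inverse q * (if len R u < len R (\<sigma> \<alpha> \<circ> u) then \<rho> z (\<sigma> \<alpha> \<circ> u) w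
      else (q - 1) * \<rho> z u w + q * \<rho> z (\<sigma> \<alpha> \<circ> u) w)
    + (1 - inverse q) * c_term (act w z) \<alpha> * \<rho> z u w"
proof -
  have "\<kappa> z w \<alpha> * \<rho> z u (\<sigma> \<alpha> \<circ> w) = \<tau> (\<mu> z w * \<mu> (act w z) (\<sigma> \<alpha>)) u"
    using assms by (simp add: mu_mult_refl \<tau>_scale \<rho>_def)
  also have "\<dots> = inverse q * \<tau> (\<mu> z w * T (\<sigma> \<alpha>)) u + (1 - inverse q) * c_term (act w z) \<alpha> * \<rho> z u w"
    using mu_simple_act[OF assms(1,3,4)]
    by (simp add: distrib_left \<tau>_add \<tau>_scale \<rho>_def flip: scale_mult_right)
  finally show ?thesis
    by (simp add: \<tau>_mult_T_refl assms \<rho>_def)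
qed

lemma \<rho>_id: "z \<in> regular R \<Longrightarrow> u \<in> W \<Longrightarrow> \<rho> z u id = (if u = id then 1 else 0)"
  using \<tau>_T[OF weyl_id, of u] by (simp add: \<rho>_def mu_id T_id)

lemma \<rho>_support:
  assumes z: "z \<in> regular R" and "v \<in> W" and "u \<in> W" and "\<rho> z u v \<noteq> 0"
  shows "u \<preceq> v"
proof -
  have "\<forall>u\<in>W. \<rho> z u v \<noteq> 0 \<longrightarrow> u \<preceq> v"
    using assms(2)
  proof (induction rule: weyl_len_induct)
    case id
    show "\<forall>u\<in>W. \<rho> z u id \<noteq> 0 \<longrightarrow> u \<preceq> id" using z by (simp add: \<rho>_id)
  next
    case (refl \<alpha> w)
    note IH = refl(4)[rule_format]
    show "\<forall>u\<in>W. \<rho> z u (\<sigma> \<alpha> \<circ> w) \<noteq> 0 \<longrightarrow> u \<preceq> \<sigma> \<alpha> \<circ> w"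
    proof (intro ballI impI)
      fix u assume u: "u \<in> W" "\<rho> z u (\<sigma> \<alpha> \<circ> w) \<noteq> 0"
      have le: "w \<preceq> \<sigma> \<alpha> \<circ> w" using bruhat_up[of w \<alpha>] refl by simp
      have su: "\<sigma> \<alpha> \<circ> u \<in> W" using u refl(1) by simp
      have "\<kappa> z w \<alpha> = 1" using refl(3) by (simp add: \<kappa>_def)
      then have "\<rho> z (\<sigma> \<alpha> \<circ> u) w \<noteq> 0 \<or> \<rho> z u w \<noteq> 0"
        using \<rho>_refl[OF z u(1) refl(2,1)] u(2) by (auto split: if_splits)
      then show "u \<preceq> \<sigma> \<alpha> \<circ> w"
      proof
        assume "\<rho> z (\<sigma> \<alpha> \<circ> u) w \<noteq> 0"
        then have "\<sigma> \<alpha> \<circ> u \<preceq> w" using IH su by blast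
        then show ?thesis
          using bruhat_refl_lower[OF _ su refl(1)] refl(1) le bruhat_trans[of u w] by auto
      next
        assume "\<rho> z u w \<noteq> 0"
        then show ?thesis using IH u le bruhat_trans by blast
      qed
    qed
  qed
  then show ?thesis using assms by blast
qed

lemma \<rho>_diag:
  assumes z: "z \<in> regular R" and "v \<in> W"
  shows "\<rho> z v v = 1"
  using assms(2)
proof (induction rule: weyl_len_induct)
  case id
  show "\<rho> z id id = 1" using z by (simp add: \<rho>_id weyl_id)
next
  case (refl \<alpha> w)
  let ?w = "\<sigma> \<alpha> \<circ> w"
  have W: "?w \<in> W" using refl by simp
  have "\<not> ?w \<preceq> w" using bruhat_len[of ?w w] refl(3) by auto
  then have 0: "\<rho> z ?w w = 0" using \<rho>_support[OF z refl(2) W] by blast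
  have "\<rho> z w w = 1" using refl(4) .
  moreover have "\<kappa> z w \<alpha> = 1" using refl(3) by (simp add: \<kappa>_def)
  ultimately show "\<rho> z ?w ?w = 1"
    using \<rho>_refl[OF z W refl(2,1)] refl(1,3) 0 by simp
qed

lemma sgn_len_refl: "w \<in> W \<Longrightarrow> \<alpha> \<in> \<Delta> \<Longrightarrow> sgn_len R (\<sigma> \<alpha> \<circ> w) = - sgn_len R w"
  by (simp add: sgn_len_def len_refl_parity)

text \<open>Since \<open>w\<^sub>0\<close> complements lengths, ascents of
  \<open>w\<^sub>0 \<circ> w\<close> match descents of \<open>w\<close>, that is, ascents of
  \<open>\<sigma> \<alpha> \<circ> w\<close>. On both sides c is replaced by -1 - c.\<close>

lemma \<kappa>_longest:
  assumes "z \<in> regular R" and "w \<in> W" and "\<alpha> \<in> \<Delta>"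
  shows "\<kappa> z (w\<^sub>0 \<circ> w) (- w\<^sub>0 \<alpha>) = \<kappa> z (\<sigma> \<alpha> \<circ> w) \<alpha>"
proof -
  have "\<sigma> (- w\<^sub>0 \<alpha>) \<circ> (w\<^sub>0 \<circ> w) = w\<^sub>0 \<circ> (\<sigma> \<alpha> \<circ> w)"
    using refl_longest[OF assms(3)] by (simp flip: comp_assoc)
  then have "len R (w\<^sub>0 \<circ> w) < len R (\<sigma> (- w\<^sub>0 \<alpha>) \<circ> (w\<^sub>0 \<circ> w)) \<longleftrightarrow> len R (\<sigma> \<alpha> \<circ> w) < len R w"
    using len_longest_comp[of w] len_longest_comp[of "\<sigma> \<alpha> \<circ> w"] assms by auto
  then show ?thesis
    using assms by (simp add: \<kappa>_def c_term_act_longest c_term_act_refl)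
qed

text \<open>The recursion for the coefficients \<open>\<rho> (w\<^sub>0 \<circ> v) (w\<^sub>0 \<circ> x)\<close> is the one that right
  multiplication by \<open>T (\<sigma> \<alpha>)\<close> induces on the expansion of \<open>T (inv v)\<close>.\<close>

lemma \<rho>_longest_refl:
  assumes z: "z \<in> regular R" and v: "v \<in> W" and x: "x \<in> W" and \<alpha>: "\<alpha> \<in> \<Delta>"
    and up: "len R (\<sigma> \<alpha> \<circ> v) = Suc (len R v)"
  shows "\<rho> z (w\<^sub>0 \<circ> (\<sigma> \<alpha> \<circ> v)) (w\<^sub>0 \<circ> x) =
    \<kappa> z (\<sigma> \<alpha> \<circ> x) \<alpha> * \<rho> z (w\<^sub>0 \<circ> v) (w\<^sub>0 \<circ> (\<sigma> \<alpha> \<circ> x))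
    + (1 - inverse q) * c_term (act x z) \<alpha> * \<rho> z (w\<^sub>0 \<circ> v) (w\<^sub>0 \<circ> x)"
proof -
  let ?\<alpha> = "- w\<^sub>0 \<alpha>" and ?p = "w\<^sub>0 \<circ> v" and ?y = "w\<^sub>0 \<circ> x"
  have W: "?p \<in> W" "?y \<in> W" using v x by simp_all
  have conj: "\<sigma> ?\<alpha> \<circ> (w\<^sub>0 \<circ> w) = w\<^sub>0 \<circ> (\<sigma> \<alpha> \<circ> w)" for w
    using refl_longest[OF \<alpha>] by (simp flip: comp_assoc)
  \<comment> \<open>An ascent of \<open>v\<close> is a descent of \<open>?p\<close> for the
    conjugate reflection. So the second branch of \<open>\<rho>_refl\<close> applies, where the
    wanted coefficient carries the factor q, cancelled by \<open>inverse q\<close>; its term with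
    \<open>q - 1\<close> cancels against the -1 from the inverted c.\<close>
  have "\<not> len R ?p < len R (\<sigma> ?\<alpha> \<circ> ?p)"
    using len_longest_comp[of v] len_longest_comp[of "\<sigma> \<alpha> \<circ> v"] up v \<alpha> by (simp add: conj)
  then have "\<kappa> z (\<sigma> \<alpha> \<circ> x) \<alpha> * \<rho> z ?p (w\<^sub>0 \<circ> (\<sigma> \<alpha> \<circ> x)) =
      inverse q * ((q - 1) * \<rho> z ?p ?y + q * \<rho> z (w\<^sub>0 \<circ> (\<sigma> \<alpha> \<circ> v)) ?y)
      + (1 - inverse q) * (- 1 - c_term (act x z) \<alpha>) * \<rho> z ?p ?y"
    using \<rho>_refl[OF z W longest_simple[OF \<alpha>]] z x \<alpha>
    by (simp add: conj \<kappa>_longest c_term_act_longest)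
  then have "\<kappa> z (\<sigma> \<alpha> \<circ> x) \<alpha> * \<rho> z ?p (w\<^sub>0 \<circ> (\<sigma> \<alpha> \<circ> x)) = (inverse q * q) * \<rho> z (w\<^sub>0 \<circ> (\<sigma> \<alpha> \<circ> v)) ?y
      + (inverse q * q - 1) * \<rho> z ?p ?y - (1 - inverse q) * c_term (act x z) \<alpha> * \<rho> z ?p ?y"
    by (simp only:) (simp add: algebra_simps del: left_inverse right_inverse)
  then show ?thesis by simp
qed

theorem T_expansion:
  assumes z: "z \<in> regular R" and "v \<in> W"
  shows "T (inv v) = (\<Sum>x\<in>W.
    scale (qlen R v * sgn_len R x * sgn_len R v * \<rho> z (w\<^sub>0 \<circ> v) (w\<^sub>0 \<circ> x)) (\<mu> z x))"
  using assms(2)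
proof (induction rule: weyl_len_induct)
  case id
  \<comment> \<open>As \<open>w\<^sub>0\<close> is the top element, the support condition leaves
    only \<open>x = id\<close>.\<close>
  have "\<rho> z w\<^sub>0 (w\<^sub>0 \<circ> x) = (if x = id then 1 else 0)" if x: "x \<in> W" for x
  proof (cases "x = id")
    case False
    then have "\<not> w\<^sub>0 \<preceq> w\<^sub>0 \<circ> x"
      using bruhat_longest_iff[OF x weyl_id] bruhat_len[of x id] by auto
    then show ?thesis using False \<rho>_support[OF z, of "w\<^sub>0 \<circ> x" w\<^sub>0] x by auto
  qed (simp add: \<rho>_diag z)
  then have "(\<Sum>x\<in>W. scale (qlen R id * sgn_len R x * sgn_len R id * \<rho> z (w\<^sub>0 \<circ> id) (w\<^sub>0 \<circ> x)) (\<mu> z x))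
      = (\<Sum>x\<in>W. if x = id then scale (sgn_len R x * sgn_len R id) (\<mu> z x) else 0)"
    by (intro sum.cong) simp_all
  also have "\<dots> = T (inv id)"
    by (simp add: finite_weyl weyl_id sgn_len_def mu_id[OF z] T_id)
  finally show "T (inv id) = (\<Sum>x\<in>W.
      scale (qlen R id * sgn_len R x * sgn_len R id * \<rho> z (w\<^sub>0 \<circ> id) (w\<^sub>0 \<circ> x)) (\<mu> z x))" ..
next
  case (refl \<alpha> v)
  let ?B = "\<lambda>v x. qlen R v * sgn_len R x * sgn_len R v * \<rho> z (w\<^sub>0 \<circ> v) (w\<^sub>0 \<circ> x)"
  let ?s = "\<lambda>x. \<sigma> \<alpha> \<circ> x"
  note \<alpha> = refl(1) and v = refl(2) and up = refl(3)
  have IH: "T (inv v) = (\<Sum>x\<in>W. scale (?B v x) (\<mu> z x))" using refl(4) .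
  have "T (inv (?s v)) = (\<Sum>x\<in>W. scale (?B v x) (\<mu> z x)) * T (\<sigma> \<alpha>)"
    using T_refl_right(1)[OF v \<alpha> up] IH by simp
  also have "\<dots> = (\<Sum>x\<in>W. scale (?B v x * (q * \<kappa> z x \<alpha>)) (\<mu> z (?s x)))
      - (\<Sum>x\<in>W. scale (?B v x * ((q - 1) * c_term (act x z) \<alpha>)) (\<mu> z x))"
    by (simp add: sum_distrib_right mu_mult_T_refl z \<alpha> scale_right_diff_distrib
        flip: scale_mult_left sum_subtractf)
  \<comment> \<open>The shift of the index changes the sign of x. That supplies the minus sign which
    the second sum already has, so both acquire the sign of \<open>?s v\<close>.\<close>
  also have "(\<Sum>x\<in>W. scale (?B v x * (q * \<kappa> z x \<alpha>)) (\<mu> z (?s x)))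
      = (\<Sum>x\<in>W. scale (?B v (?s x) * (q * \<kappa> z (?s x) \<alpha>)) (\<mu> z x))"
    by (rule sum.reindex_bij_witness[where i = ?s and j = ?s]) (use \<alpha> in auto)
  also have "\<dots> - (\<Sum>x\<in>W. scale (?B v x * ((q - 1) * c_term (act x z) \<alpha>)) (\<mu> z x))
      = (\<Sum>x\<in>W. scale (?B (?s v) x) (\<mu> z x))"
    unfolding sum_subtractf[symmetric] scale_left_diff_distrib[symmetric]
  proof (rule sum.cong[OF HOL.refl], rule arg_cong2[where f = scale, OF _ HOL.refl])
    fix x assume x: "x \<in> W"
    have q: "q * (1 - inverse q) = q - 1" by (simp add: field_simps)
    show "?B v (?s x) * (q * \<kappa> z (?s x) \<alpha>) - ?B v x * ((q - 1) * c_term (act x z) \<alpha>) = ?B (?s v) x"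
      unfolding \<rho>_longest_refl[OF z v x \<alpha> up] qlen_Suc[OF up] sgn_len_refl[OF v \<alpha>] sgn_len_refl[OF x \<alpha>]
        q[symmetric]
      by (simp add: algebra_simps)
  qed
  finally show "T (inv (?s v)) = (\<Sum>x\<in>W. scale (?B (?s v) x) (\<mu> z x))" .
qed

section \<open>The two inversion formulas\<close>

lemma \<rho>_inverse:
  assumes "z \<in> regular R" and "u \<in> W" and "v \<in> W"
  shows "(\<Sum>x\<in>W. \<rho> z u x * sgn_len R x * sgn_len R v * \<rho> z (w\<^sub>0 \<circ> v) (w\<^sub>0 \<circ> x)) =
    (if u = v then 1 else 0)"
proof -
  have "qlen R v * (\<Sum>x\<in>W. \<rho> z u x * sgn_len R x * sgn_len R v * \<rho> z (w\<^sub>0 \<circ> v) (w\<^sub>0 \<circ> x))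
      = \<tau> (T (inv v)) u"
    unfolding T_expansion[OF assms(1,3)] \<tau>_sum \<tau>_scale sum_distrib_left
    by (intro sum.cong) (simp_all add: \<rho>_def)
  then show ?thesis using assms by (auto simp: \<tau>_T split: if_splits)
qed

lemma r_inverse:
  assumes z: "z \<in> regular R" and u: "u \<in> W" and v: "v \<in> W"
  shows "(\<Sum>x\<in>interval u v. r_coeff R scale T \<mu> z u x * sgn_len R x * sgn_len R v *
    r_coeff R scale T \<mu> z (w\<^sub>0 \<circ> v) (w\<^sub>0 \<circ> x)) = (if u = v then 1 else 0)"
proof -
  let ?f = "\<lambda>x. \<rho> z u x * sgn_len R x * sgn_len R v * \<rho> z (w\<^sub>0 \<circ> v) (w\<^sub>0 \<circ> x)"
  have "?f x = 0" if "x \<in> W - interval u v" for x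
    using that \<rho>_support[OF z, of x u] \<rho>_support[OF z, of "w\<^sub>0 \<circ> x" "w\<^sub>0 \<circ> v"] u v
      bruhat_longest_iff[of x v] by (auto simp: interval_def)
  then have "(\<Sum>x\<in>interval u v. ?f x) = (\<Sum>x\<in>W. ?f x)"
    by (intro sum.mono_neutral_left finite_weyl) (auto simp: interval_def)
  \<comment> \<open>\<open>bar\<close> is additive and multiplicative and fixes the signs, so the
    identity for \<rho> becomes the one for r.\<close>
  then have "bar (\<Sum>x\<in>interval u v. ?f x) = bar (if u = v then 1 else 0)"
    using \<rho>_inverse[OF assms] by simp
  then show ?thesis
    by (simp add: bar_sum bar_mult r_coeff_eq sgn_len_def if_distrib cong: if_cong)
qed

lemma m_support:
  assumes z: "z \<in> regular R" and "u \<in> W" and "v \<in> W" and "m_coeff R scale T \<mu> z u v \<noteq> 0"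
  shows "u \<preceq> v"
proof -
  obtain x where "x \<in> W" "u \<preceq> x" "\<rho> z x v \<noteq> 0"
    using assms(4) unfolding m_coeff_eq by (metis (mono_tags, lifting) mem_Collect_eq sum.neutral)
  then show ?thesis using \<rho>_support z assms(3) bruhat_trans by blast
qed

text \<open>As \<open>w\<^sub>0\<close> reverses the order,
  \<open>m (w\<^sub>0 \<circ> v) (w\<^sub>0 \<circ> x)\<close> sums \<rho> over all t below
  \<open>v\<close>. Summing over x first leaves only y = t, with \<open>u \<preceq> y\<close> and
  \<open>y \<preceq> v\<close>, and hence the signed sum over the interval.\<close>

lemma m_inverse:
  assumes z: "z \<in> regular R" and u: "u \<in> W" and v: "v \<in> W" and "u \<preceq> v"
  shows "(\<Sum>x\<in>interval u v. m_coeff R scale T \<mu> z u x * sgn_len R x * sgn_len R v *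
    m_coeff R scale T \<mu> z (w\<^sub>0 \<circ> v) (w\<^sub>0 \<circ> x)) = (if u = v then 1 else 0)"
proof -
  let ?m = "m_coeff R scale T \<mu> z" and ?\<epsilon> = "sgn_len R"
  let ?U = "{y \<in> W. u \<preceq> y}" and ?V = "{y \<in> W. y \<preceq> v}"
  let ?f = "\<lambda>x. ?m u x * ?\<epsilon> x * ?\<epsilon> v * ?m (w\<^sub>0 \<circ> v) (w\<^sub>0 \<circ> x)"
  have fin: "finite ?U" "finite ?V" by (simp_all add: finite_weyl)
  have \<epsilon>: "?\<epsilon> y * ?\<epsilon> y = 1" for y
    by (simp add: sgn_len_def flip: power_add)
  have "?f x = 0" if "x \<in> W - interval u v" for x
    using that m_support[OF z u, of x] m_support[OF z, of "w\<^sub>0 \<circ> v" "w\<^sub>0 \<circ> x"] v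
      bruhat_longest_iff[of x v] by (auto simp: interval_def)
  then have "(\<Sum>x\<in>interval u v. ?f x) = (\<Sum>x\<in>W. ?f x)"
    by (intro sum.mono_neutral_left finite_weyl) (auto simp: interval_def)
  also have "\<dots> = (\<Sum>x\<in>W. \<Sum>y\<in>?U. \<Sum>t\<in>?V.
      ?\<epsilon> v * ?\<epsilon> t * (\<rho> z y x * ?\<epsilon> x * ?\<epsilon> t * \<rho> z (w\<^sub>0 \<circ> t) (w\<^sub>0 \<circ> x)))"
  proof (rule sum.cong[OF refl])
    fix x assume "x \<in> W"
    have "?m (w\<^sub>0 \<circ> v) (w\<^sub>0 \<circ> x) = (\<Sum>t\<in>?V. \<rho> z (w\<^sub>0 \<circ> t) (w\<^sub>0 \<circ> x))"
      unfolding m_coeff_eq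
      by (rule sum.reindex_bij_witness[where i = "\<lambda>t. w\<^sub>0 \<circ> t" and j = "\<lambda>t. w\<^sub>0 \<circ> t"])
        (use bruhat_longest_iff[OF _ v] bruhat_longest[of "w\<^sub>0 \<circ> v"] v in auto)
    then have "?f x = (\<Sum>y\<in>?U. \<Sum>t\<in>?V. \<rho> z y x * ?\<epsilon> x * ?\<epsilon> v * \<rho> z (w\<^sub>0 \<circ> t) (w\<^sub>0 \<circ> x))"
      by (simp add: m_coeff_eq[of z u] sum_distrib_left sum_distrib_right) (rule sum.swap)
    \<comment> \<open>\<open>?\<epsilon> t\<close> is inserted twice, so that the bracket is a
      summand of \<open>\<rho>_inverse\<close> at y and t.\<close>
    also have "\<dots> = (\<Sum>y\<in>?U. \<Sum>t\<in>?V.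
        ?\<epsilon> v * ?\<epsilon> t * (\<rho> z y x * ?\<epsilon> x * ?\<epsilon> t * \<rho> z (w\<^sub>0 \<circ> t) (w\<^sub>0 \<circ> x)))"
    proof (intro sum.cong refl)
      fix y t
      have "?\<epsilon> v * ?\<epsilon> t * (\<rho> z y x * ?\<epsilon> x * ?\<epsilon> t * \<rho> z (w\<^sub>0 \<circ> t) (w\<^sub>0 \<circ> x))
          = (?\<epsilon> t * ?\<epsilon> t) * (\<rho> z y x * ?\<epsilon> x * ?\<epsilon> v * \<rho> z (w\<^sub>0 \<circ> t) (w\<^sub>0 \<circ> x))"
        by (simp only: ac_simps)
      then show "\<rho> z y x * ?\<epsilon> x * ?\<epsilon> v * \<rho> z (w\<^sub>0 \<circ> t) (w\<^sub>0 \<circ> x)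
          = ?\<epsilon> v * ?\<epsilon> t * (\<rho> z y x * ?\<epsilon> x * ?\<epsilon> t * \<rho> z (w\<^sub>0 \<circ> t) (w\<^sub>0 \<circ> x))"
        by (simp add: \<epsilon>)
    qed
    finally show "?f x = \<dots>" .
  qed
  also have "\<dots> = (\<Sum>y\<in>?U. \<Sum>t\<in>?V. \<Sum>x\<in>W.
      ?\<epsilon> v * ?\<epsilon> t * (\<rho> z y x * ?\<epsilon> x * ?\<epsilon> t * \<rho> z (w\<^sub>0 \<circ> t) (w\<^sub>0 \<circ> x)))"
    by (subst sum.swap) (intro sum.cong refl sum.swap)
  also have "\<dots> = (\<Sum>y\<in>?U. \<Sum>t\<in>?V. ?\<epsilon> v * ?\<epsilon> t * (if y = t then 1 else 0))"
    by (intro sum.cong refl) (simp add: \<rho>_inverse[OF z] flip: sum_distrib_left)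
  also have "\<dots> = (\<Sum>y\<in>?U. if y \<in> ?V then ?\<epsilon> v * ?\<epsilon> y else 0)"
    using fin by (intro sum.cong refl) (simp add: if_distrib sum.delta cong: if_cong)
  also have "\<dots> = (\<Sum>y\<in>?U \<inter> ?V. ?\<epsilon> v * ?\<epsilon> y)"
    using fin by (simp only: sum.inter_restrict)
  also have "?U \<inter> ?V = interval u v"
    by (auto simp: interval_def)
  also have "(\<Sum>y\<in>interval u v. ?\<epsilon> v * ?\<epsilon> y)
      = ?\<epsilon> v * of_int (\<Sum>y\<in>interval u v. (- 1) ^ len R y)"
    by (simp add: sgn_len_def sum_distrib_left)
  also have "\<dots> = (if u = v then 1 else 0)"
  proof (cases "u = v")
    case True
    have "y = v" if "y \<in> interval v v" for y
      using bruhat_len[of v y] bruhat_len[of y v] that by (auto simp: interval_def)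
    then have "interval v v = {v}" using v by (auto simp: interval_def)
    then show ?thesis using True \<epsilon>[of v] by (simp add: sgn_len_def)
  next
    case False
    then show ?thesis using interval_sign_sum[OF u v] by simp
  qed
  finally show ?thesis .
qed

end

theorem theorem5:
  fixes R :: "('x::ab_group_add) root_data"
    and scale :: "ratfun \<Rightarrow> 'h::ring_1 \<Rightarrow> 'h"
    and T :: "('x \<Rightarrow> 'x) \<Rightarrow> 'h"
    and \<mu> :: "('x \<Rightarrow> complex) \<Rightarrow> ('x \<Rightarrow> 'x) \<Rightarrow> 'h"
    and z :: "'x \<Rightarrow> complex"
    and u v :: "'x \<Rightarrow> 'x"
  assumes "mu_family R scale T \<mu>"
    and "z \<in> regular R"
    and "u \<in> weyl R" and "v \<in> weyl R" and "bruhat R u v"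
  defines "r \<equiv> r_coeff R scale T \<mu> z"
    and "m \<equiv> m_coeff R scale T \<mu> z"
    and "\<epsilon> \<equiv> sgn_len R"
    and "w0 \<equiv> longest R"
  shows "(\<Sum>x \<in> {x \<in> weyl R. bruhat R u x \<and> bruhat R x v}.
           r u x * \<epsilon> x * \<epsilon> v * r (w0 \<circ> v) (w0 \<circ> x)) = (if u = v then 1 else 0) \<and>
         (\<Sum>x \<in> {x \<in> weyl R. bruhat R u x \<and> bruhat R x v}.
           m u x * \<epsilon> x * \<epsilon> v * m (w0 \<circ> v) (w0 \<circ> x)) = (if u = v then 1 else 0)"
proof -
  interpret mu_family R scale T \<mu> by fact
  show ?thesis
    using r_inverse[OF assms(2-4)] m_inverse[OF assms(2-5)]
    unfolding interval_def r_def m_def \<epsilon>_def w0_def by blast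
qed

end
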